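(* Let $(\Omega,\mathcal F,\mathfrak F,\mathbf P)$ be a filtered probability space with right-continuous filtration, $Z$ an $\mathbb R^+$-valued local $(\mathfrak F,\mathbf P)$-martingale with $\mathbf P$-a.s. $Z_0=1$, and $(\rho_n)_{n\in\mathbb N}$ an increasing sequence of $\mathfrak F$-stopping times such that $Z^{\rho_n}$ is a uniformly integrable $(\mathfrak F,\mathbf P)$-martingale for all $n$. Let $\rho=\lim_n\rho_n$. Assume that $(\Omega,\mathcal F_{\rho_n-})_{n\in\mathbb N}$ is a standard system and denote by $\mathbf Q$ the unique probability measure on $(\Omega,\mathcal F_{\rho-})$ such that $\mathbf Q(F)=\mathbf E[Z_{\rho_n}\mathbf 1_F]$ for all $F\in\mathcal F_{\rho_n-}$ and $n\in\mathbb N$. (i) If $\lim_{n\to\infty}\mathbf Q(\rho_n>t)=1$ for all $t\ge0$, then $Z$ is an $(\mathfrak F,\mathbf P)$-martingale. If $\mathbf P$-a.s. $\rho_n\uparrow\infty$ and $Z$ is an $(\mathfrak F,\mathbf P)$-martingale, then $\lim_{n\to\infty}\mathbf Q(\rho_n>t)=1$ for all $t\ge0$. (ii) If $\lim_{n\to\infty}\mathbf Q(\rho_n=\infty)=1$, then $Z$ is a uniformly integrable $(\mathfrak F,\mathbf P)$-martingale.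
   Context: Filtrations are right-continuous but not assumed complete. $\mathcal F_{\rho-}$ is the $\sigma$-field generated by $\mathcal F_0$ and the sets $F\cap\{t<\rho\}$, $t\ge0$, $F\in\mathcal F_t$. On $\{\rho_n=\infty\}$, $Z_{\rho_n}:=\lim_{t\to\infty}Z_t$. Local martingales are càdlàg with localizing sequence of stopping times a.s. increasing to $\infty$ along which the stopped processes are uniformly integrable martingales. An atom of a measurable space $(E,\mathcal E)$ is a (non-empty) set $A\in\mathcal E$ such that $A'\subseteq A$, $A'\in\mathcal E$ implies $A'=A$ or $A'=\emptyset$. A measurable space is a standard Borel space (Parthasarathy's sense) if its $\sigma$-field is $\sigma$-isomorphic to the Borel $\sigma$-field of some Polish space (points need not be separated). For an index set $\mathbb T\subseteq\mathbb R^+$, a system $(\Omega,\mathcal G_t)_{t\in\mathbb T}$ is a standard system if: $\mathcal G_t\subseteq\mathcal G_{t'}$ for $t\le t'$; each $(\Omega,\mathcal G_t)$ is a standard Borel space; and for any increasing sequence $(t_n)$ in $\mathbb T$ and any decreasing sequence $(A_n)$ with $A_n$ an atom of $(\Omega,\mathcal G_{t_n})$, $\bigcap_nA_n\ne\emptyset$. (Existence and uniqueness of $\mathbf Q$ follow from Parthasarathy's extension theorem.) *)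

theory Defs
  imports "HOL-Probability.Probability"
begin

section \<open>Filtrations, stopping times and processes\<close>

text \<open>
  Time is \<open>[0, \<infinity>)\<close>, modelled by the nonnegative reals inside the type real; values of processes
  and filtrations at negative arguments are never used. Random times take values in
  \<open>[0, \<infinity>]\<close>, modelled by the type ennreal. Filtrations are not assumed to be complete.
\<close>

locale filtered_prob_space = prob_space M
  for M :: "'a measure" +
  fixes F :: "real \<Rightarrow> 'a measure"
  assumes subalgebra_F: "\<And>t. 0 \<le> t \<Longrightarrow> subalgebra M (F t)"
    and sets_F_mono: "\<And>s t. 0 \<le> s \<Longrightarrow> s \<le> t \<Longrightarrow> sets (F s) \<subseteq> sets (F t)"

definition right_continuous_filtration :: "(real \<Rightarrow> 'a measure) \<Rightarrow> bool" where
  "right_continuous_filtration F \<longleftrightarrow> (\<forall>t\<ge>0. sets (F t) = (\<Inter>s\<in>{t<..}. sets (F s)))"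

text \<open>
  The library constant \<open>stopping_time\<close> requires filtration and time to share one index type, so it
  does not cover times in \<open>[0, \<infinity>]\<close> together with a filtration indexed by \<open>[0, \<infinity>)\<close>.
\<close>

definition ext_stopping_time :: "(real \<Rightarrow> 'a measure) \<Rightarrow> ('a \<Rightarrow> ennreal) \<Rightarrow> bool" where
  "ext_stopping_time F \<tau> \<longleftrightarrow>
     (\<forall>t\<ge>0. {\<omega> \<in> space (F t). \<tau> \<omega> \<le> ennreal t} \<in> sets (F t))"

definition strict_past :: "'a set \<Rightarrow> (real \<Rightarrow> 'a measure) \<Rightarrow> ('a \<Rightarrow> ennreal) \<Rightarrow> 'a measure" where
  "strict_past \<Omega> F \<tau> = sigma \<Omega>
     (sets (F 0) \<union> {A \<inter> {\<omega> \<in> \<Omega>. ennreal t < \<tau> \<omega>} | A t. 0 \<le> t \<and> A \<in> sets (F t)})"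

definition cadlag_paths :: "'a set \<Rightarrow> (real \<Rightarrow> 'a \<Rightarrow> real) \<Rightarrow> bool" where
  "cadlag_paths \<Omega> X \<longleftrightarrow> (\<forall>\<omega>\<in>\<Omega>.
     (\<forall>t\<ge>0. ((\<lambda>s. X s \<omega>) \<longlongrightarrow> X t \<omega>) (at_right t)) \<and>
     (\<forall>t>0. \<exists>l. ((\<lambda>s. X s \<omega>) \<longlongrightarrow> l) (at_left t)))"

definition stopped :: "(real \<Rightarrow> 'a \<Rightarrow> real) \<Rightarrow> ('a \<Rightarrow> ennreal) \<Rightarrow> real \<Rightarrow> 'a \<Rightarrow> real" where
  "stopped X \<tau> t \<omega> = X (enn2real (min (\<tau> \<omega>) (ennreal t))) \<omega>"

text \<open>
  On the event that the time is infinite, the value is the limit of the path. Where this limit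
  fails to exist, \<open>Lim\<close> returns one fixed but unspecified real number.
\<close>

definition value_at :: "(real \<Rightarrow> 'a \<Rightarrow> real) \<Rightarrow> ('a \<Rightarrow> ennreal) \<Rightarrow> 'a \<Rightarrow> real" where
  "value_at X \<tau> \<omega> =
     (if \<tau> \<omega> = \<infinity> then Lim at_top (\<lambda>t. X t \<omega>) else X (enn2real (\<tau> \<omega>)) \<omega>)"


section \<open>Martingales\<close>

definition martingale :: "'a measure \<Rightarrow> (real \<Rightarrow> 'a measure) \<Rightarrow> (real \<Rightarrow> 'a \<Rightarrow> real) \<Rightarrow> bool" where
  "martingale M F X \<longleftrightarrow>
     (\<forall>t\<ge>0. X t \<in> borel_measurable (F t)) \<and>
     (\<forall>t\<ge>0. integrable M (X t)) \<and>
     (\<forall>s t. 0 \<le> s \<longrightarrow> s \<le> t \<longrightarrow> (AE \<omega> in M. real_cond_exp M (F s) (X t) \<omega> = X s \<omega>))"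

definition uniformly_integrable :: "'a measure \<Rightarrow> 'i set \<Rightarrow> ('i \<Rightarrow> 'a \<Rightarrow> real) \<Rightarrow> bool" where
  "uniformly_integrable M I X \<longleftrightarrow>
     (\<forall>i\<in>I. integrable M (X i)) \<and>
     (\<forall>\<epsilon>>0. \<exists>K. \<forall>i\<in>I. (LINT \<omega>:{\<omega> \<in> space M. K < \<bar>X i \<omega>\<bar>}|M. \<bar>X i \<omega>\<bar>) \<le> \<epsilon>)"

definition ui_martingale :: "'a measure \<Rightarrow> (real \<Rightarrow> 'a measure) \<Rightarrow> (real \<Rightarrow> 'a \<Rightarrow> real) \<Rightarrow> bool" where
  "ui_martingale M F X \<longleftrightarrow> martingale M F X \<and> uniformly_integrable M {0..} X"

definition local_martingale :: "'a measure \<Rightarrow> (real \<Rightarrow> 'a measure) \<Rightarrow> (real \<Rightarrow> 'a \<Rightarrow> real) \<Rightarrow> bool" where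
  "local_martingale M F X \<longleftrightarrow>
     (\<forall>t\<ge>0. X t \<in> borel_measurable (F t)) \<and>
     cadlag_paths (space M) X \<and>
     (\<exists>\<tau> :: nat \<Rightarrow> 'a \<Rightarrow> ennreal.
        (\<forall>n. ext_stopping_time F (\<tau> n)) \<and>
        (AE \<omega> in M. incseq (\<lambda>n. \<tau> n \<omega>) \<and> (\<lambda>n. \<tau> n \<omega>) \<longlonglongrightarrow> \<infinity>) \<and>
        (\<forall>n. ui_martingale M F (stopped X (\<tau> n))))"


section \<open>Standard systems\<close>

text \<open>As for sub-\<open>\<sigma>\<close>-fields elsewhere, measures serve only as carriers of a measurable space here.\<close>

definition measurable_atom :: "'a measure \<Rightarrow> 'a set \<Rightarrow> bool" where
  "measurable_atom E A \<longleftrightarrow>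
     A \<in> sets E \<and> A \<noteq> {} \<and> (\<forall>A'\<in>sets E. A' \<subseteq> A \<longrightarrow> A' = A \<or> A' = {})"

definition sigma_isomorphic :: "'a measure \<Rightarrow> 'b measure \<Rightarrow> bool" where
  "sigma_isomorphic E B \<longleftrightarrow> (\<exists>\<phi>.
     bij_betw \<phi> (sets E) (sets B) \<and>
     (\<forall>A\<in>sets E. \<phi> (space E - A) = space B - \<phi> A) \<and>
     (\<forall>A :: nat \<Rightarrow> 'a set. range A \<subseteq> sets E \<longrightarrow> \<phi> (\<Union>i. A i) = (\<Union>i. \<phi> (A i))))"

definition polish_topology :: "'a topology \<Rightarrow> bool" where
  "polish_topology X \<longleftrightarrow> completely_metrizable_space X \<and> second_countable X"

text \<open>
  A Polish space has at most the cardinality of the continuum and is therefore homeomorphic to one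
  whose underlying set is a set of reals (with an arbitrary Polish topology, not the one
  inherited from the real line). So ranging over the topologies \<open>X :: real topology\<close> ranges over
  all Polish spaces up to homeomorphism. The isomorphism is one of \<open>\<sigma>\<close>-fields, not of points:
  \<open>E\<close> need not separate points.
\<close>

definition standard_borel_space :: "'a measure \<Rightarrow> bool" where
  "standard_borel_space E \<longleftrightarrow> (\<exists>X :: real topology.
     polish_topology X \<and> sigma_isomorphic E (sigma (topspace X) {U. openin X U}))"

definition standard_system :: "'i::linorder set \<Rightarrow> 'a set \<Rightarrow> ('i \<Rightarrow> 'a measure) \<Rightarrow> bool" where
  "standard_system T \<Omega> G \<longleftrightarrow>
     (\<forall>t\<in>T. space (G t) = \<Omega>) \<and>
     (\<forall>t\<in>T. \<forall>t'\<in>T. t \<le> t' \<longrightarrow> sets (G t) \<subseteq> sets (G t')) \<and>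
     (\<forall>t\<in>T. standard_borel_space (G t)) \<and>
     (\<forall>(t :: nat \<Rightarrow> 'i) A. range t \<subseteq> T \<longrightarrow> incseq t \<longrightarrow> decseq A \<longrightarrow>
        (\<forall>n. measurable_atom (G (t n)) (A n)) \<longrightarrow> (\<Inter>n. A n) \<noteq> {})"

end

theory Submission
  imports Defs
begin

text \<open>
  On \<open>{\<rho> n > t}\<close> the stopped process at time \<open>t\<close> equals \<open>Z t\<close>, so once \<open>value_at Z (\<rho> n)\<close> is known
  to close the stopped martingale, \<open>Q (\<rho> n > t) = E[Z t; \<rho> n > t]\<close>. As \<open>Z\<close> is a supermartingale with
  initial expectation 1, it is a martingale iff \<open>E[Z t] = 1\<close> for all \<open>t\<close>; and if \<open>Q (\<rho> n = \<infinity>)\<close> tends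
  to 1, then \<open>Z\<close> inherits uniform integrability from its stopped versions, up to the mass
  \<open>1 - Q (\<rho> n = \<infinity>)\<close>.

  Closing the martingale requires almost sure convergence of a nonnegative right-continuous
  martingale \<open>X\<close>. The bounded submartingale \<open>U = exp (- X)\<close> satisfies
  \<open>E[(U t - U s)\<^sup>2] \<le> E[(U t)\<^sup>2] - E[(U s)\<^sup>2]\<close>, and this remains true for \<open>U\<close> stopped at the first
  time it moves by more than \<open>\<epsilon>\<close> away from \<open>U s\<close>. As \<open>E[(U t)\<^sup>2]\<close> increases to a finite limit, almost
  every path of \<open>U\<close> is Cauchy.
\<close>

section \<open>Convergence of nonnegative martingales\<close>

text \<open>The hypothesis compares only with the single value \<open>u s\<close>, which is the form
  an exit estimate delivers. Passing through \<open>u s\<close> bounds the oscillation beyond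
  \<open>s\<close>; completeness then gives a limit along the integers, and the same bound carries
  it to all real times.\<close>

lemma convergent_at_top_if_Cauchy:
  fixes u :: "real \<Rightarrow> real"
  assumes "\<And>e. 0 < e \<Longrightarrow> \<exists>s. \<forall>t\<ge>s. \<bar>u t - u s\<bar> \<le> e"
  shows "\<exists>l. (u \<longlongrightarrow> l) at_top"
proof -
  have *: "\<exists>s. \<forall>t\<ge>s. \<forall>t'\<ge>s. \<bar>u t - u t'\<bar> < e" if e: "0 < e" for e
  proof -
    obtain s where s: "\<forall>t\<ge>s. \<bar>u t - u s\<bar> \<le> e/3"
      using assms[of "e/3"] e by auto
    have "\<bar>u t - u t'\<bar> < e" if "t \<ge> s" "t' \<ge> s" for t t'
      using s[rule_format, OF that(1)] s[rule_format, OF that(2)] \<open>0 < e\<close> by linarith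
    then show ?thesis by blast
  qed
  have "Cauchy (\<lambda>n. u (real n))"
  proof (rule metric_CauchyI)
    fix e :: real assume "0 < e"
    from *[OF this] obtain s where s: "\<forall>t\<ge>s. \<forall>t'\<ge>s. \<bar>u t - u t'\<bar> < e" by blast
    show "\<exists>N. \<forall>m\<ge>N. \<forall>n\<ge>N. dist (u (real m)) (u (real n)) < e"
      using s by (intro exI[of _ "nat \<lceil>s\<rceil>"]) (simp add: dist_real_def nat_le_iff ceiling_le_iff)
  qed
  then obtain l where l: "(\<lambda>n. u (real n)) \<longlonglongrightarrow> l"
    by (auto simp: Cauchy_convergent_iff convergent_def)
  have "(u \<longlongrightarrow> l) at_top"
  proof (rule tendstoI)
    fix e :: real assume "0 < e"
    then obtain s where s: "\<forall>t\<ge>s. \<forall>t'\<ge>s. \<bar>u t - u t'\<bar> < e/2" using *[of "e/2"] by auto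
    obtain N where N: "\<forall>n\<ge>N. \<bar>u (real n) - l\<bar> < e/2"
      using l \<open>0 < e\<close> unfolding lim_sequentially dist_real_def by (meson half_gt_zero)
    define n where "n = max N (nat \<lceil>s\<rceil>)"
    have n: "\<bar>u (real n) - l\<bar> < e/2" "real n \<ge> s"
      using N unfolding n_def by (simp, linarith)
    show "\<forall>\<^sub>F t in at_top. dist (u t) l < e"
      using eventually_ge_at_top[of s]
    proof eventually_elim
      case (elim t)
      then have "\<bar>u t - u (real n)\<bar> < e/2" using s n by blast
      then show ?case using n(1) unfolding dist_real_def by linarith
    qed
  qed
  then show ?thesis ..
qed

text \<open>Positivity of \<open>l\<close> excludes escape of \<open>x\<close> to infinity; at a
  positive point \<open>ln\<close> is continuous.\<close>

lemma exp_tendsto_imp_tendsto: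
  fixes x :: "'b \<Rightarrow> real"
  assumes "((\<lambda>t. exp (- x t)) \<longlongrightarrow> l) G" "0 < l"
  shows "(x \<longlongrightarrow> - ln l) G"
proof -
  have "((\<lambda>t. - ln (exp (- x t))) \<longlongrightarrow> - ln l) G"
    by (intro tendsto_intros assms) (use assms in auto)
  then show ?thesis by simp
qed

section \<open>Measurability along the filtration and martingales tested against bounded
  factors\<close>

context filtered_prob_space
begin

lemma measurable_F_imp:
  assumes "0 \<le> t" "f \<in> measurable (F t) N"
  shows "f \<in> measurable M N"
  using subalgebra_F[OF assms(1)] assms(2) by (rule measurable_from_subalg)

lemma space_F: "0 \<le> t \<Longrightarrow> space (F t) = space M"
  using subalgebra_F by (simp add: subalgebra_def)

lemma sets_F_subset: "0 \<le> t \<Longrightarrow> A \<in> sets (F t) \<Longrightarrow> A \<in> sets M"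
  using subalgebra_F by (auto simp: subalgebra_def)

lemma measurable_F_mono:
  assumes "0 \<le> s" "s \<le> t" "f \<in> measurable (F s) N"
  shows "f \<in> measurable (F t) N"
  using assms sets_F_mono[of s t] space_F[of s] space_F[of t] by (auto simp: measurable_def)

lemma integrable_bounded:
  fixes f :: "'a \<Rightarrow> real"
  assumes "f \<in> borel_measurable M" "\<And>\<omega>. \<omega> \<in> space M \<Longrightarrow> \<bar>f \<omega>\<bar> \<le> B"
  shows "integrable M f"
  using assms by (intro integrable_const_bound[of _ B]) auto

text \<open>This is the form in which the martingale property is used throughout: \<open>H\<close>
  constantly 1 yields constancy of the mean, an indicator yields equality of integrals over events
  of \<open>F s\<close>. Boundedness of \<open>H\<close> makes the product integrable, so the
  characteristic property of the conditional expectation applies.\<close>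

lemma martingale_integral_mult:
  fixes H :: "'a \<Rightarrow> real"
  assumes "martingale M F X" "0 \<le> s" "s \<le> t" and H: "H \<in> borel_measurable (F s)"
    and bnd: "\<And>\<omega>. \<omega> \<in> space M \<Longrightarrow> \<bar>H \<omega>\<bar> \<le> B"
  shows "integrable M (\<lambda>\<omega>. H \<omega> * X t \<omega>)"
    and "(\<integral>\<omega>. H \<omega> * X t \<omega> \<partial>M) = (\<integral>\<omega>. H \<omega> * X s \<omega> \<partial>M)"
proof -
  have X: "integrable M (X t)" "AE \<omega> in M. real_cond_exp M (F s) (X t) \<omega> = X s \<omega>"
      "X s \<in> borel_measurable (F s)"
    using assms unfolding martingale_def by auto
  have HM [measurable]: "H \<in> borel_measurable M" and [measurable]: "X s \<in> borel_measurable M"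
    using measurable_F_imp[OF \<open>0 \<le> s\<close>] H X(3) by auto
  interpret sub: finite_measure_subalgebra M "F s"
    by unfold_locales (rule subalgebra_F[OF \<open>0 \<le> s\<close>])
  show int: "integrable M (\<lambda>\<omega>. H \<omega> * X t \<omega>)"
  proof (rule Bochner_Integration.integrable_bound)
    show "integrable M (\<lambda>\<omega>. B * X t \<omega>)" using X(1) by simp
    show "AE \<omega> in M. norm (H \<omega> * X t \<omega>) \<le> norm (B * X t \<omega>)"
    proof (rule AE_I2)
      fix \<omega> assume "\<omega> \<in> space M"
      then have "\<bar>H \<omega>\<bar> \<le> \<bar>B\<bar>" using bnd[of \<omega>] by linarith
      then show "norm (H \<omega> * X t \<omega>) \<le> norm (B * X t \<omega>)" by (simp add: abs_mult mult_right_mono)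
    qed
  qed (use X(1) in measurable)
  have "(\<integral>\<omega>. H \<omega> * X t \<omega> \<partial>M) = (\<integral>\<omega>. H \<omega> * real_cond_exp M (F s) (X t) \<omega> \<partial>M)"
    using sub.real_cond_exp_intg(2)[OF int H] X(1) by simp
  also have "\<dots> = (\<integral>\<omega>. H \<omega> * X s \<omega> \<partial>M)"
    using X(2) by (intro integral_cong_AE) auto
  finally show "(\<integral>\<omega>. H \<omega> * X t \<omega> \<partial>M) = (\<integral>\<omega>. H \<omega> * X s \<omega> \<partial>M)" .
qed

end

section \<open>The bounded submartingale \<open>exp (- X)\<close> and its exit probabilities\<close>

locale nonneg_martingale = filtered_prob_space M F
  for M :: "'a measure" and F +
  fixes X :: "real \<Rightarrow> 'a \<Rightarrow> real"
  assumes martingale: "martingale M F X"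
    and nonneg: "\<And>t \<omega>. 0 \<le> t \<Longrightarrow> \<omega> \<in> space M \<Longrightarrow> 0 \<le> X t \<omega>"
begin

lemma X_measurable_F: "0 \<le> t \<Longrightarrow> X t \<in> borel_measurable (F t)"
  and X_integrable: "0 \<le> t \<Longrightarrow> integrable M (X t)"
  using martingale by (auto simp: martingale_def)

lemma X_measurable: "0 \<le> t \<Longrightarrow> X t \<in> borel_measurable M"
  using X_integrable by auto

text \<open>Jensen's inequality for \<open>exp (- c * x)\<close>, via the tangent line of \<open>exp\<close> at \<open>X s\<close>.\<close>

lemma exp_submartingale:
  assumes "0 \<le> s" "s \<le> t" "0 \<le> c" and H: "H \<in> borel_measurable (F s)"
    and bnd: "\<And>\<omega>. \<omega> \<in> space M \<Longrightarrow> 0 \<le> H \<omega> \<and> H \<omega> \<le> B"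
  shows "(\<integral>\<omega>. H \<omega> * exp (- c * X s \<omega>) \<partial>M) \<le> (\<integral>\<omega>. H \<omega> * exp (- c * X t \<omega>) \<partial>M)"
proof -
  have t: "0 \<le> t" using assms by simp
  note [measurable] = X_measurable[OF \<open>0 \<le> s\<close>] X_measurable[OF t] measurable_F_imp[OF \<open>0 \<le> s\<close> H]
  define K where "K \<omega> = H \<omega> * exp (- c * X s \<omega>)" for \<omega>
  have K: "K \<in> borel_measurable (F s)"
    unfolding K_def using H X_measurable_F[OF \<open>0 \<le> s\<close>] by measurable
  have e: "H \<omega> * exp (- c * X u \<omega>) \<in> {0..B}" if "\<omega> \<in> space M" "0 \<le> u" for \<omega> u
  proof -
    have "exp (- c * X u \<omega>) \<le> 1" using nonneg[OF that(2,1)] \<open>0 \<le> c\<close> by simp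
    then have "H \<omega> * exp (- c * X u \<omega>) \<le> B * 1" using bnd[OF that(1)] by (intro mult_mono) auto
    then show ?thesis using bnd[OF that(1)] by simp
  qed
  have Kb: "\<bar>K \<omega>\<bar> \<le> B" if "\<omega> \<in> space M" for \<omega> using e[OF that \<open>0 \<le> s\<close>] unfolding K_def by simp
  note mt = martingale_integral_mult[OF martingale \<open>0 \<le> s\<close> \<open>s \<le> t\<close> K Kb]
  note ms = martingale_integral_mult[OF martingale \<open>0 \<le> s\<close> order_refl K Kb]
  have iK: "integrable M K" unfolding K_def by (rule integrable_bounded[of _ B]) (use e[OF _ \<open>0 \<le> s\<close>] in auto)
  \<comment> \<open>The subtracted term has integral zero by the martingale property, since
    \<open>K\<close> is bounded and known at time \<open>s\<close>. The integrand becomes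
    \<open>H\<close> times the tangent line of \<open>exp (- c * x)\<close> at \<open>X s\<close>,
    evaluated at \<open>X t\<close>.\<close>
  have "(\<integral>\<omega>. K \<omega> \<partial>M) = (\<integral>\<omega>. K \<omega> - c * (K \<omega> * X t \<omega> - K \<omega> * X s \<omega>) \<partial>M)"
    using mt ms iK by simp
  also have "\<dots> \<le> (\<integral>\<omega>. H \<omega> * exp (- c * X t \<omega>) \<partial>M)"
  proof (rule integral_mono)
    show "integrable M (\<lambda>\<omega>. K \<omega> - c * (K \<omega> * X t \<omega> - K \<omega> * X s \<omega>))"
      using mt(1) ms(1) iK by auto
    show "integrable M (\<lambda>\<omega>. H \<omega> * exp (- c * X t \<omega>))"
      by (rule integrable_bounded[of _ B]) (use e[OF _ t] in auto)
    fix \<omega> assume \<omega>: "\<omega> \<in> space M"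
    have "1 - c * (X t \<omega> - X s \<omega>) \<le> exp (- c * (X t \<omega> - X s \<omega>))"
      using exp_ge_add_one_self[of "- c * (X t \<omega> - X s \<omega>)"] by simp
    then have "K \<omega> * (1 - c * (X t \<omega> - X s \<omega>)) \<le> K \<omega> * exp (- c * (X t \<omega> - X s \<omega>))"
      using e[OF \<omega> \<open>0 \<le> s\<close>] by (intro mult_left_mono) (auto simp: K_def)
    also have "\<dots> = H \<omega> * exp (- c * X t \<omega>)"
      unfolding K_def by (simp add: mult_exp_exp algebra_simps)
    finally show "K \<omega> - c * (K \<omega> * X t \<omega> - K \<omega> * X s \<omega>) \<le> H \<omega> * exp (- c * X t \<omega>)"
      by (simp add: algebra_simps)
  qed
  finally show ?thesis unfolding K_def .
qed

text \<open>
  Kolmogorov's inequality for the bounded submartingale \<open>exp (- X)\<close>. The process \<open>W\<close> is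
  \<open>exp (- X)\<close> frozen at its first exit from the \<open>\<epsilon>\<close>-neighbourhood of its initial value.
\<close>

lemma exit_inequality:
  fixes \<tau> :: "nat \<Rightarrow> real"
  assumes "0 \<le> \<tau> 0" "mono \<tau>" "0 < \<epsilon>"
  shows "prob {\<omega> \<in> space M. \<exists>k\<le>N. \<epsilon> < \<bar>exp (- X (\<tau> k) \<omega>) - exp (- X (\<tau> 0) \<omega>)\<bar>} * \<epsilon>\<^sup>2
         \<le> (\<integral>\<omega>. exp (- 2 * X (\<tau> N) \<omega>) \<partial>M) - (\<integral>\<omega>. exp (- 2 * X (\<tau> 0) \<omega>) \<partial>M)"
proof -
  have \<tau>0: "0 \<le> \<tau> k" for k using \<open>mono \<tau>\<close> assms(1) by (meson le0 monoD order_trans)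
  have \<tau>m: "j \<le> k \<Longrightarrow> \<tau> j \<le> \<tau> k" for j k using \<open>mono \<tau>\<close> by (rule monoD)
  define U where "U k \<omega> = exp (- X (\<tau> k) \<omega>)" for k \<omega>
  define G where "G k = {\<omega> \<in> space M. \<forall>j\<le>k. \<bar>U j \<omega> - U 0 \<omega>\<bar> \<le> \<epsilon>}" for k
  \<comment> \<open>On \<open>G k\<close> no exit has occurred up to index \<open>k\<close>, and
    \<open>W\<close> still makes the step to \<open>Suc k\<close>. Hence it is frozen at the first
    value outside the neighbourhood, not at the last one inside.\<close>
  define W where "W = rec_nat (U 0) (\<lambda>k w \<omega>. if \<omega> \<in> G k then U (Suc k) \<omega> else w \<omega>)"
  have W0: "W 0 = U 0" and WS: "W (Suc k) \<omega> = (if \<omega> \<in> G k then U (Suc k) \<omega> else W k \<omega>)" for k \<omega>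
    unfolding W_def by simp_all
  have U_F: "U j \<in> borel_measurable (F (\<tau> k))" if "j \<le> k" for j k
    unfolding U_def using measurable_F_mono[OF \<tau>0 \<tau>m[OF that] X_measurable_F[OF \<tau>0]] by measurable
  have U2: "exp (- 2 * X (\<tau> k) \<omega>) = (U k \<omega>)\<^sup>2" for k \<omega>
    unfolding U_def by (simp add: power2_eq_square mult_exp_exp)
  have G_F: "G k \<in> sets (F (\<tau> k))" for k
  proof -
    have "{\<omega> \<in> space (F (\<tau> k)). \<bar>U j \<omega> - U 0 \<omega>\<bar> \<le> \<epsilon>} \<in> sets (F (\<tau> k))" if "j \<le> k" for j
      using borel_measurable_abs[OF borel_measurable_diff[OF U_F[OF that] U_F[OF le0]]]
      unfolding borel_measurable_iff_le by blast
    then have "{\<omega> \<in> space (F (\<tau> k)). \<forall>j\<in>{..k}. \<bar>U j \<omega> - U 0 \<omega>\<bar> \<le> \<epsilon>} \<in> sets (F (\<tau> k))"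
      by (intro sets.sets_Collect_finite_All) (simp_all only: atMost_iff finite_atMost)
    then show ?thesis unfolding G_def space_F[OF \<tau>0] by (simp only: Ball_def atMost_iff)
  qed
  have [measurable]: "U k \<in> borel_measurable M" for k
    unfolding U_def using X_measurable[OF \<tau>0] by measurable
  have [measurable]: "G k \<in> sets M" for k using sets_F_subset[OF \<tau>0 G_F] .
  have [measurable]: "W k \<in> borel_measurable M" for k
  proof (induction k)
    case (Suc k)
    have "W (Suc k) = (\<lambda>\<omega>. if \<omega> \<in> G k then U (Suc k) \<omega> else W k \<omega>)" using WS by auto
    then show ?case using Suc by simp
  qed (simp add: W0)
  have Ub: "0 \<le> U k \<omega> \<and> U k \<omega> \<le> 1" if "\<omega> \<in> space M" for k \<omega>
    unfolding U_def using nonneg[OF \<tau>0 that] by simp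
  have Wb: "0 \<le> W k \<omega> \<and> W k \<omega> \<le> 1" if "\<omega> \<in> space M" for k \<omega>
    by (induction k) (use Ub[OF that] in \<open>auto simp: W0 WS\<close>)
  have prod_b: "\<bar>a * b\<bar> \<le> 1" if "0 \<le> a \<and> a \<le> 1" "0 \<le> b \<and> b \<le> 1" for a b :: real
    using mult_mono[of a 1 b 1] that by auto
  have WG: "W k \<omega> = U k \<omega>" if "\<omega> \<in> G k" for k \<omega>
    using that by (cases k) (auto simp: W0 WS G_def)
  have exit: "(\<exists>j\<le>k. \<epsilon> < \<bar>U j \<omega> - U 0 \<omega>\<bar>) \<Longrightarrow> \<epsilon> < \<bar>W k \<omega> - U 0 \<omega>\<bar>" if "\<omega> \<in> space M" for k \<omega>
  proof (induction k)
    case (Suc k)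
    show ?case
    proof (cases "\<omega> \<in> G k")
      case True
      then have "\<epsilon> < \<bar>U (Suc k) \<omega> - U 0 \<omega>\<bar>" using Suc.prems by (auto simp: G_def le_Suc_eq not_le[symmetric])
      then show ?thesis using True by (simp add: WS)
    next
      case False
      then have "\<exists>j\<le>k. \<epsilon> < \<bar>U j \<omega> - U 0 \<omega>\<bar>" using that by (auto simp: G_def not_le)
      then show ?thesis using Suc.IH False by (simp add: WS)
    qed
  qed (use \<open>0 < \<epsilon>\<close> in auto)
  have iUW [simp]: "integrable M (\<lambda>\<omega>. U j \<omega> * W k \<omega>)" for j k
    by (rule integrable_bounded[of _ 1]) (use prod_b Ub Wb in auto)
  have iUU [simp]: "integrable M (\<lambda>\<omega>. U j \<omega> * U k \<omega>)" for j k
    by (rule integrable_bounded[of _ 1]) (use prod_b Ub in auto)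
  have iWW [simp]: "integrable M (\<lambda>\<omega>. W j \<omega> * W k \<omega>)" for j k
    by (rule integrable_bounded[of _ 1]) (use prod_b Wb in auto)
  \<comment> \<open>\<open>W\<close> moves in step \<open>k\<close> only on \<open>G k\<close>,
    where it follows \<open>U\<close>. Both this event and the nonnegative weight \<open>U 0\<close>
    are known at time \<open>\<tau> k\<close>, so the weighted mean of the increment is nonnegative
    by the submartingale inequality with \<open>c = 1\<close>.\<close>
  have a: "(\<integral>\<omega>. U 0 \<omega> * U 0 \<omega> \<partial>M) \<le> (\<integral>\<omega>. U 0 \<omega> * W k \<omega> \<partial>M)" for k
  proof (induction k)
    case (Suc k)
    define H where "H \<omega> = indicator (G k) \<omega> * U 0 \<omega>" for \<omega>
    have H: "H \<in> borel_measurable (F (\<tau> k))"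
      unfolding H_def using U_F[OF le0, of k] G_F[of k] by measurable
    have Hb: "0 \<le> H \<omega> \<and> H \<omega> \<le> 1" if "\<omega> \<in> space M" for \<omega>
      unfolding H_def using Ub[OF that] by (auto simp: indicator_def)
    have iH: "integrable M (\<lambda>\<omega>. H \<omega> * U j \<omega>)" for j
      by (rule integrable_bounded[of _ 1]) (use prod_b Hb Ub measurable_F_imp[OF \<tau>0 H] in auto)
    have "(\<integral>\<omega>. H \<omega> * U k \<omega> \<partial>M) \<le> (\<integral>\<omega>. H \<omega> * U (Suc k) \<omega> \<partial>M)"
      using exp_submartingale[OF \<tau>0 \<tau>m, of k "Suc k" 1, OF _ _ H Hb] by (simp add: U_def)
    then have "0 \<le> (\<integral>\<omega>. H \<omega> * U (Suc k) \<omega> - H \<omega> * U k \<omega> \<partial>M)" using iH by simp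
    also have "\<dots> = (\<integral>\<omega>. U 0 \<omega> * W (Suc k) \<omega> - U 0 \<omega> * W k \<omega> \<partial>M)"
      by (rule Bochner_Integration.integral_cong) (auto simp: H_def WS WG indicator_def)
    finally show ?case using Suc by simp
  qed (simp add: W0)
  have b: "(\<integral>\<omega>. W k \<omega> * W k \<omega> \<partial>M) \<le> (\<integral>\<omega>. U k \<omega> * U k \<omega> \<partial>M)" for k
  proof (induction k)
    case (Suc k)
    define H :: "'a \<Rightarrow> real" where "H \<omega> = indicator (space (F (\<tau> k)) - G k) \<omega>" for \<omega>
    have H: "H \<in> borel_measurable (F (\<tau> k))"
      unfolding H_def using G_F[of k] by measurable
    have Hb: "0 \<le> H \<omega> \<and> H \<omega> \<le> 1" if "\<omega> \<in> space M" for \<omega>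
      unfolding H_def by (auto simp: indicator_def)
    have iH: "integrable M (\<lambda>\<omega>. H \<omega> * (U j \<omega> * U j \<omega>))" for j
    proof (rule integrable_bounded[of _ 1])
      fix \<omega> assume "\<omega> \<in> space M"
      then have "0 \<le> U j \<omega> * U j \<omega> \<and> U j \<omega> * U j \<omega> \<le> 1" using Ub[of \<omega> j] prod_b[of "U j \<omega>" "U j \<omega>"] by auto
      then show "\<bar>H \<omega> * (U j \<omega> * U j \<omega>)\<bar> \<le> 1" using prod_b Hb[OF \<open>\<omega> \<in> space M\<close>] by blast
    qed (use measurable_F_imp[OF \<tau>0 H] in measurable)
    have "(\<integral>\<omega>. H \<omega> * (U k \<omega> * U k \<omega>) \<partial>M) \<le> (\<integral>\<omega>. H \<omega> * (U (Suc k) \<omega> * U (Suc k) \<omega>) \<partial>M)"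
      using exp_submartingale[OF \<tau>0 \<tau>m, of k "Suc k" 2, OF _ _ H Hb] by (simp add: U_def mult_exp_exp)
    then have "0 \<le> (\<integral>\<omega>. H \<omega> * (U (Suc k) \<omega> * U (Suc k) \<omega>) - H \<omega> * (U k \<omega> * U k \<omega>) \<partial>M)" using iH by simp
    also have "\<dots> = (\<integral>\<omega>. (U (Suc k) \<omega> * U (Suc k) \<omega> - W (Suc k) \<omega> * W (Suc k) \<omega>)
        - (U k \<omega> * U k \<omega> - W k \<omega> * W k \<omega>) \<partial>M)"
      by (rule Bochner_Integration.integral_cong) (auto simp: H_def WS WG indicator_def space_F[OF \<tau>0])
    finally show ?case using Suc by simp
  qed (simp add: W0)
  have sq: "(W N \<omega> - U 0 \<omega>)\<^sup>2 = W N \<omega> * W N \<omega> - 2 * (U 0 \<omega> * W N \<omega>) + U 0 \<omega> * U 0 \<omega>" for \<omega>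
    by (simp add: power2_eq_square algebra_simps)
  have isq: "integrable M (\<lambda>\<omega>. (W N \<omega> - U 0 \<omega>)\<^sup>2)"
    unfolding sq by simp
  \<comment> \<open>A path that has left the neighbourhood by index \<open>N\<close> is, by
    \<open>exit\<close>, still displaced by more than \<open>\<epsilon>\<close> in
    \<open>W N\<close>. So Chebyshev's inequality at the single index \<open>N\<close> controls the
    maximum.\<close>
  have "prob {\<omega> \<in> space M. \<exists>k\<le>N. \<epsilon> < \<bar>U k \<omega> - U 0 \<omega>\<bar>} \<le> prob {\<omega> \<in> space M. \<epsilon>\<^sup>2 \<le> (W N \<omega> - U 0 \<omega>)\<^sup>2}"
  proof (rule finite_measure_mono)
    show "{\<omega> \<in> space M. \<exists>k\<le>N. \<epsilon> < \<bar>U k \<omega> - U 0 \<omega>\<bar>} \<subseteq> {\<omega> \<in> space M. \<epsilon>\<^sup>2 \<le> (W N \<omega> - U 0 \<omega>)\<^sup>2}"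
    proof safe
      fix \<omega> k assume "\<omega> \<in> space M" "k \<le> N" "\<epsilon> < \<bar>U k \<omega> - U 0 \<omega>\<bar>"
      then have "\<epsilon> \<le> \<bar>W N \<omega> - U 0 \<omega>\<bar>" using exit[of \<omega> N] by (meson less_imp_le)
      then show "\<epsilon>\<^sup>2 \<le> (W N \<omega> - U 0 \<omega>)\<^sup>2" using \<open>0 < \<epsilon>\<close> by (simp add: abs_le_square_iff[symmetric])
    qed
  qed measurable
  also have "\<dots> \<le> (\<integral>\<omega>. (W N \<omega> - U 0 \<omega>)\<^sup>2 \<partial>M) / \<epsilon>\<^sup>2"
    using \<open>0 < \<epsilon>\<close> isq by (intro integral_Markov_inequality_measure[where A="{}"]) auto
  finally have "prob {\<omega> \<in> space M. \<exists>k\<le>N. \<epsilon> < \<bar>U k \<omega> - U 0 \<omega>\<bar>} * \<epsilon>\<^sup>2 \<le> (\<integral>\<omega>. (W N \<omega> - U 0 \<omega>)\<^sup>2 \<partial>M)"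
    using \<open>0 < \<epsilon>\<close> by (simp add: pos_le_divide_eq)
  also have "\<dots> = (\<integral>\<omega>. W N \<omega> * W N \<omega> - 2 * (U 0 \<omega> * W N \<omega>) + U 0 \<omega> * U 0 \<omega> \<partial>M)"
    by (simp only: sq)
  also have "\<dots> = (\<integral>\<omega>. W N \<omega> * W N \<omega> \<partial>M) - 2 * (\<integral>\<omega>. U 0 \<omega> * W N \<omega> \<partial>M) + (\<integral>\<omega>. U 0 \<omega> * U 0 \<omega> \<partial>M)"
    by simp
  \<comment> \<open>\<open>b\<close> bounds the square of \<open>W N\<close>, and \<open>a\<close>
    bounds the cross term by twice the mean square of \<open>U 0\<close>, of which one copy
    cancels.\<close>
  also have "\<dots> \<le> (\<integral>\<omega>. U N \<omega> * U N \<omega> \<partial>M) - (\<integral>\<omega>. U 0 \<omega> * U 0 \<omega> \<partial>M)"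
    using a[of N] b[of N] by simp
  finally show ?thesis unfolding U2 by (simp add: U_def power2_eq_square)
qed

section \<open>Almost sure convergence of the paths\<close>

lemma expectation_const:
  assumes "0 \<le> t"
  shows "expectation (X t) = expectation (X 0)"
  using martingale_integral_mult(2)[OF martingale order_refl assms, of "\<lambda>_. 1" 1] by simp

text \<open>The exit inequality sees only finitely many times. Dyadic grids that become both finer
  and longer exhaust a dense set of times after \<open>s\<close>, and right continuity reaches the
  remaining ones. The cost of an exit after \<open>s\<close> is at most \<open>L - m s\<close>,
  which is small for suitable \<open>s\<close>.\<close>

lemma AE_exp_convergent:
  assumes rc: "\<And>t \<omega>. 0 \<le> t \<Longrightarrow> \<omega> \<in> space M \<Longrightarrow> ((\<lambda>s. X s \<omega>) \<longlongrightarrow> X t \<omega>) (at_right t)"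
  shows "AE \<omega> in M. \<exists>l. ((\<lambda>t. exp (- X t \<omega>)) \<longlongrightarrow> l) at_top"
proof -
  define U where "U t \<omega> = exp (- X t \<omega>)" for t \<omega>
  define m where "m t = (\<integral>\<omega>. exp (- 2 * X t \<omega>) \<partial>M)" for t
  define L where "L = (SUP t\<in>{0..}. m t)"
  have U_meas [measurable]: "U t \<in> borel_measurable M" if "0 \<le> t" for t
    unfolding U_def using X_measurable[OF that] by measurable
  have m_le: "m t \<le> 1" if "0 \<le> t" for t
  proof -
    have "m t \<le> (\<integral>\<omega>. 1 \<partial>M)" unfolding m_def
    proof (rule integral_mono)
      show "integrable M (\<lambda>\<omega>. exp (- 2 * X t \<omega>))"
        by (rule integrable_bounded[of _ 1]) (use X_measurable[OF that] nonneg[OF that] in auto)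
    qed (use nonneg[OF that] in auto)
    then show ?thesis by (simp add: prob_space)
  qed
  have bdd: "bdd_above (m ` {0..})" using m_le by (intro bdd_aboveI[of _ 1]) auto
  have mL: "m t \<le> L" if "0 \<le> t" for t unfolding L_def using bdd that by (intro cSUP_upper) auto
  have near: "\<exists>s\<ge>0. L - m s < \<delta>" if "0 < \<delta>" for \<delta>
  proof -
    have "L - \<delta> < L" using that by simp
    then obtain s where "s \<in> {0..}" "L - \<delta> < m s"
      unfolding L_def using less_cSUP_iff[OF _ bdd] by auto
    then show ?thesis by (intro exI[of _ s]) auto
  qed
  \<comment> \<open>Mesh \<open>1 / 2 ^ n\<close> with indices up to \<open>4 ^ n\<close> reaches
    \<open>s + 2 ^ n\<close>, so one limit in \<open>n\<close> refines the grid and lengthens it at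
    once. Doubling an index embeds each grid in the next.\<close>
  define E where "E \<epsilon> s n = {\<omega> \<in> space M. \<exists>k\<le>4 ^ n. \<epsilon> < \<bar>U (s + real k / 2 ^ n) \<omega> - U s \<omega>\<bar>}" for \<epsilon> s and n :: nat
  define B where "B \<epsilon> s = (\<Union>n. E \<epsilon> s n)" for \<epsilon> s
  have E_sets [measurable]: "E \<epsilon> s n \<in> sets M" if "0 \<le> s" for \<epsilon> s n
  proof -
    have [measurable]: "U s \<in> borel_measurable M" "\<And>k. U (s + real k / 2 ^ n) \<in> borel_measurable M"
      using that by (auto intro!: U_meas)
    show ?thesis unfolding E_def by measurable
  qed
  have B_sets: "B \<epsilon> s \<in> sets M" if "0 \<le> s" for \<epsilon> s
    unfolding B_def using E_sets[OF that] by blast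
  have E_prob: "prob (E \<epsilon> s n) * \<epsilon>\<^sup>2 \<le> L - m s" if "0 \<le> s" "0 < \<epsilon>" for \<epsilon> s n
  proof -
    have "mono (\<lambda>k. s + real k / 2 ^ n)" by (intro monoI) (simp add: divide_right_mono)
    from exit_inequality[OF _ this that(2), of "4 ^ n"] that
    have "prob (E \<epsilon> s n) * \<epsilon>\<^sup>2 \<le> m (s + real (4 ^ n) / 2 ^ n) - m s"
      unfolding E_def U_def m_def by simp
    then show ?thesis using mL[of "s + real (4 ^ n) / 2 ^ n"] that by simp
  qed
  have B_prob: "prob (B \<epsilon> s) * \<epsilon>\<^sup>2 \<le> L - m s" if "0 \<le> s" "0 < \<epsilon>" for \<epsilon> s
  proof -
    have "incseq (E \<epsilon> s)"
    proof (rule incseq_SucI, rule subsetI)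
      fix n \<omega> assume "\<omega> \<in> E \<epsilon> s n"
      then obtain k where k: "k \<le> 4 ^ n" "\<omega> \<in> space M" "\<epsilon> < \<bar>U (s + real k / 2 ^ n) \<omega> - U s \<omega>\<bar>"
        unfolding E_def by auto
      then have "2 * k \<le> 4 ^ Suc n" "\<epsilon> < \<bar>U (s + real (2 * k) / 2 ^ Suc n) \<omega> - U s \<omega>\<bar>" by auto
      then show "\<omega> \<in> E \<epsilon> s (Suc n)" unfolding E_def using k(2) by blast
    qed
    then have "(\<lambda>n. prob (E \<epsilon> s n)) \<longlonglongrightarrow> prob (B \<epsilon> s)"
      unfolding B_def using E_sets[OF that(1)] by (intro finite_Lim_measure_incseq) auto
    then have "(\<lambda>n. prob (E \<epsilon> s n) * \<epsilon>\<^sup>2) \<longlonglongrightarrow> prob (B \<epsilon> s) * \<epsilon>\<^sup>2" by (intro tendsto_intros)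
    then show ?thesis using E_prob[OF that] by (intro LIMSEQ_le_const2) auto
  qed
  have B_out: "\<bar>U t \<omega> - U s \<omega>\<bar> \<le> \<epsilon>"
    if s: "0 \<le> s" "s \<le> t" and \<omega>: "\<omega> \<in> space M" "\<omega> \<notin> B \<epsilon> s" for \<epsilon> s t \<omega>
  proof (rule ccontr)
    assume "\<not> \<bar>U t \<omega> - U s \<omega>\<bar> \<le> \<epsilon>"
    then have gt: "\<epsilon> < \<bar>U t \<omega> - U s \<omega>\<bar>" by simp
    \<comment> \<open>A strict deviation at \<open>t\<close> persists on an interval
      \<open>(t, b)\<close> by right continuity, and this interval meets a sufficiently fine
      grid.\<close>
    have "((\<lambda>u. \<bar>U u \<omega> - U s \<omega>\<bar>) \<longlongrightarrow> \<bar>U t \<omega> - U s \<omega>\<bar>) (at_right t)"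
      unfolding U_def using s \<omega> by (intro tendsto_intros rc) auto
    from order_tendstoD(1)[OF this gt] obtain b where
      b: "t < b" "\<And>u. t < u \<Longrightarrow> u < b \<Longrightarrow> \<epsilon> < \<bar>U u \<omega> - U s \<omega>\<bar>"
      unfolding eventually_at_right_field by blast
    \<comment> \<open>The first bound makes the mesh smaller than \<open>b - t\<close>; the second
      keeps the index of the grid point chosen below within \<open>4 ^ n\<close>.\<close>
    obtain n where n: "max (1 / (b - t)) (t - s + 1) < 2 ^ n"
      using real_arch_pow[of 2 "max (1 / (b - t)) (t - s + 1)"] by (metis one_less_numeral_iff semiring_norm(76))
    \<comment> \<open>Floor plus one is the first index whose grid point lies strictly to the right
      of \<open>t\<close>.\<close>
    define k where "k = nat \<lfloor>(t - s) * 2 ^ n\<rfloor> + 1"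
    have nk: "real k = of_int \<lfloor>(t - s) * 2 ^ n\<rfloor> + 1" unfolding k_def using s by simp
    have k1: "(t - s) * 2 ^ n < real k" and k2: "real k \<le> (t - s) * 2 ^ n + 1"
      unfolding nk by linarith+
    have "t < s + real k / 2 ^ n" using k1 by (simp add: field_simps)
    moreover have "s + real k / 2 ^ n < b"
    proof -
      have "1 < (b - t) * 2 ^ n" using n b(1) by (simp add: field_simps)
      then have "real k < (b - s) * 2 ^ n" using k2 by (simp add: algebra_simps)
      then show ?thesis by (simp add: field_simps)
    qed
    ultimately have "\<epsilon> < \<bar>U (s + real k / 2 ^ n) \<omega> - U s \<omega>\<bar>" by (rule b(2))
    moreover have "k \<le> 4 ^ n"
    proof -
      have "real k \<le> (t - s) * 2 ^ n + 2 ^ n" using k2 one_le_power[of "2::real" n] by linarith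
      also have "\<dots> = (t - s + 1) * 2 ^ n" by (simp add: algebra_simps)
      also have "\<dots> \<le> 2 ^ n * 2 ^ n" using n by (intro mult_right_mono) auto
      also have "\<dots> = real (4 ^ n)" by (simp flip: power_mult_distrib)
      finally show ?thesis by (simp only: of_nat_le_iff)
    qed
    ultimately have "\<omega> \<in> B \<epsilon> s" unfolding B_def E_def using \<omega>(1) by blast
    with \<omega>(2) show False ..
  qed
  have AE_step: "AE \<omega> in M. \<exists>s\<ge>0. \<forall>t\<ge>s. \<bar>U t \<omega> - U s \<omega>\<bar> \<le> \<epsilon>" if "0 < \<epsilon>" for \<epsilon>
  proof -
    have "\<exists>s\<ge>0. L - m s < inverse (real (Suc i))" for i by (rule near) simp
    then obtain s where s: "\<And>i. 0 \<le> s i" "\<And>i. L - m (s i) < inverse (real (Suc i))" by metis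
    \<comment> \<open>A path outside \<open>N\<close> stays within \<open>\<epsilon>\<close> of its
      value at one of the times \<open>s i\<close>. The event \<open>N\<close> is null because it
      lies in every \<open>B \<epsilon> (s i)\<close>, whose probability is at most
      \<open>1 / (Suc i * \<epsilon>^2)\<close>.\<close>
    define N where "N = (\<Inter>i. B \<epsilon> (s i))"
    have N: "N \<in> sets M" unfolding N_def using B_sets s(1) by auto
    have "prob N * \<epsilon>\<^sup>2 \<le> inverse (real (Suc i))" for i
    proof -
      have "prob N \<le> prob (B \<epsilon> (s i))"
        using B_sets[OF s(1)] by (intro finite_measure_mono) (auto simp: N_def)
      then have "prob N * \<epsilon>\<^sup>2 \<le> prob (B \<epsilon> (s i)) * \<epsilon>\<^sup>2" by (intro mult_right_mono) auto
      then show ?thesis using B_prob[OF s(1) that, of i] s(2)[of i] by linarith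
    qed
    then have "prob N * \<epsilon>\<^sup>2 \<le> 0" using LIMSEQ_inverse_real_of_nat by (intro LIMSEQ_le_const) auto
    then have "prob N = 0" using that measure_nonneg[of M N] by (simp add: mult_le_0_iff)
    then have "AE \<omega> in M. \<omega> \<notin> N" using prob_eq_0[OF N] by simp
    then show ?thesis
      by (rule AE_mp) (use s(1) B_out in \<open>fastforce simp: N_def\<close>)
  qed
  have "AE \<omega> in M. \<forall>i. \<exists>s\<ge>0. \<forall>t\<ge>s. \<bar>U t \<omega> - U s \<omega>\<bar> \<le> inverse (real (Suc i))"
    by (subst AE_all_countable) (intro allI AE_step, simp)
  then show ?thesis
  proof eventually_elim
    case (elim \<omega>)
    show ?case
    proof (rule convergent_at_top_if_Cauchy)
      fix e :: real assume "0 < e"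
      then obtain i where "inverse (real (Suc i)) < e" using reals_Archimedean by blast
      then show "\<exists>s. \<forall>t\<ge>s. \<bar>exp (- X t \<omega>) - exp (- X s \<omega>)\<bar> \<le> e"
        using elim[rule_format, of i] unfolding U_def by (meson less_imp_le order_trans)
    qed
  qed
qed

text \<open>Once \<open>exp (- X)\<close> converges, only divergence of \<open>X\<close> to infinity
  remains to be excluded. Fatou's lemma along the integers does this: the mean of \<open>X\<close>
  is constant, so the lower limit is almost surely finite and the limit of \<open>exp (- X)\<close>
  cannot be 0.\<close>

theorem AE_convergent:
  assumes rc: "\<And>t \<omega>. 0 \<le> t \<Longrightarrow> \<omega> \<in> space M \<Longrightarrow> ((\<lambda>s. X s \<omega>) \<longlongrightarrow> X t \<omega>) (at_right t)"
  shows "AE \<omega> in M. \<exists>l. ((\<lambda>t. X t \<omega>) \<longlongrightarrow> l) at_top"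
proof -
  have [measurable]: "X (real n) \<in> borel_measurable M" for n by (rule X_measurable) simp
  have nn: "(\<integral>\<^sup>+\<omega>. ennreal (X (real n) \<omega>) \<partial>M) = ennreal (expectation (X 0))" for n
    using expectation_const[of "real n"] nonneg X_integrable by (subst nn_integral_eq_integral) auto
  have "(\<integral>\<^sup>+\<omega>. liminf (\<lambda>n. ennreal (X (real n) \<omega>)) \<partial>M) \<le> liminf (\<lambda>n. \<integral>\<^sup>+\<omega>. ennreal (X (real n) \<omega>) \<partial>M)"
    by (rule nn_integral_liminf) measurable
  also have "\<dots> < \<infinity>" unfolding nn by (simp add: Liminf_const)
  finally have "AE \<omega> in M. liminf (\<lambda>n. ennreal (X (real n) \<omega>)) \<noteq> \<infinity>"
    by (intro nn_integral_PInf_AE) auto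
  moreover have "AE \<omega> in M. \<exists>l. ((\<lambda>t. exp (- X t \<omega>)) \<longlongrightarrow> l) at_top"
    using rc by (rule AE_exp_convergent)
  ultimately show ?thesis
  proof eventually_elim
    case (elim \<omega>)
    from elim(2) obtain l where l: "((\<lambda>t. exp (- X t \<omega>)) \<longlongrightarrow> l) at_top" by blast
    have "l \<noteq> 0"
    proof
      assume "l = 0"
      then have "(\<lambda>n. exp (- X (real n) \<omega>)) \<longlonglongrightarrow> 0"
        using filterlim_compose[OF l filterlim_real_sequentially] by simp
      then have "filterlim (\<lambda>n. exp (- X (real n) \<omega>)) (at_right 0) sequentially"
        by (simp add: filterlim_at)
      from filterlim_compose[OF ln_at_0 this] have "filterlim (\<lambda>n. X (real n) \<omega>) at_top sequentially"
        by (simp add: filterlim_uminus_at_bot)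
      then have "(\<lambda>n. ennreal (X (real n) \<omega>)) \<longlonglongrightarrow> \<infinity>"
        by (simp add: ennreal_tendsto_top_eq_at_top)
      then show False using elim(1) lim_imp_Liminf[OF sequentially_bot] by blast
    qed
    moreover have "0 \<le> l" by (rule tendsto_lowerbound[OF l]) auto
    ultimately show ?case using exp_tendsto_imp_tendsto[OF l] by auto
  qed
qed

end

section \<open>Stopping\<close>

text \<open>Existence of a limit is assumed because \<open>Lim\<close> in \<open>value_at\<close> is
  meaningful only then. This matters where \<open>\<tau>\<close> is infinite; elsewhere the stopped
  path is eventually constant.\<close>

lemma stopped_tendsto_value_at:
  assumes "\<exists>l. ((\<lambda>t. stopped Z \<tau> t \<omega>) \<longlongrightarrow> l) at_top"
  shows "((\<lambda>t. stopped Z \<tau> t \<omega>) \<longlongrightarrow> value_at Z \<tau> \<omega>) at_top"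
proof (cases "\<tau> \<omega> = \<infinity>")
  case True
  obtain l where l: "((\<lambda>t. stopped Z \<tau> t \<omega>) \<longlongrightarrow> l) at_top" using assms by blast
  have ev: "\<forall>\<^sub>F t in at_top. stopped Z \<tau> t \<omega> = Z t \<omega>"
    using eventually_ge_at_top[of 0] by eventually_elim (simp add: stopped_def True)
  then have "((\<lambda>t. Z t \<omega>) \<longlongrightarrow> l) at_top" using l tendsto_cong[OF ev] by simp
  then have "value_at Z \<tau> \<omega> = l" by (simp add: value_at_def True tendsto_Lim)
  then show ?thesis using l by simp
next
  case False
  then obtain r where r: "0 \<le> r" "\<tau> \<omega> = ennreal r" by (cases "\<tau> \<omega>") auto
  have "\<forall>\<^sub>F t in at_top. value_at Z \<tau> \<omega> = stopped Z \<tau> t \<omega>"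
    using eventually_ge_at_top[of r]
    by eventually_elim (use r in \<open>simp add: stopped_def value_at_def min_def\<close>)
  then show ?thesis by (rule tendsto_eventually[OF eventually_mono]) simp
qed

text \<open>Immediately to the right of \<open>t\<close> the stopped path is constant if stopping
  has occurred by \<open>t\<close>, and otherwise still coincides with \<open>Z\<close>.\<close>

lemma stopped_right_continuous:
  assumes Z: "((\<lambda>s. Z s \<omega>) \<longlongrightarrow> Z t \<omega>) (at_right t)" and "0 \<le> t"
  shows "((\<lambda>s. stopped Z \<tau> s \<omega>) \<longlongrightarrow> stopped Z \<tau> t \<omega>) (at_right t)"
proof (cases "\<tau> \<omega> \<le> ennreal t")
  case True
  have "\<forall>\<^sub>F s in at_right t. stopped Z \<tau> s \<omega> = stopped Z \<tau> t \<omega>"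
    using eventually_at_right_less[of t]
  proof eventually_elim
    case (elim s)
    then have "\<tau> \<omega> \<le> ennreal s" using True by (meson ennreal_leI less_imp_le order_trans)
    then show ?case using True by (simp add: stopped_def min_def)
  qed
  then show ?thesis by (rule tendsto_eventually)
next
  case False
  then have lt: "ennreal t < \<tau> \<omega>" by simp
  have "\<exists>b>t. \<forall>s>t. s < b \<longrightarrow> ennreal s \<le> \<tau> \<omega>"
  proof (cases "\<tau> \<omega>")
    case (real r)
    then have "t < r" using lt \<open>0 \<le> t\<close> by (simp add: ennreal_less_iff)
    then show ?thesis using real by (intro exI[of _ r]) (auto intro: ennreal_leI)
  next
    case top
    then show ?thesis by (intro exI[of _ "t + 1"]) auto
  qed
  then have "\<forall>\<^sub>F s in at_right t. Z s \<omega> = stopped Z \<tau> s \<omega>"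
    unfolding eventually_at_right_field using \<open>0 \<le> t\<close> by (fastforce simp: stopped_def min_def)
  moreover have "stopped Z \<tau> t \<omega> = Z t \<omega>"
    using lt \<open>0 \<le> t\<close> by (simp add: stopped_def min_absorb2 less_imp_le)
  ultimately show ?thesis using Z tendsto_cong by fastforce
qed

section \<open>Strict pasts, terminal values and nonnegative local martingales\<close>

context filtered_prob_space
begin

lemma ext_stopping_time_less:
  assumes "ext_stopping_time F \<tau>" "0 \<le> t"
  shows "{\<omega> \<in> space M. ennreal t < \<tau> \<omega>} \<in> sets (F t)"
proof -
  have "{\<omega> \<in> space M. ennreal t < \<tau> \<omega>} = space (F t) - {\<omega> \<in> space (F t). \<tau> \<omega> \<le> ennreal t}"
    using space_F[OF assms(2)] by auto
  moreover have "{\<omega> \<in> space (F t). \<tau> \<omega> \<le> ennreal t} \<in> sets (F t)"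
    using assms by (simp add: ext_stopping_time_def)
  ultimately show ?thesis by (metis sets.compl_sets)
qed

lemma strict_past_generator_Pow:
  "sets (F 0) \<union> {A \<inter> {\<omega> \<in> space M. ennreal t < \<tau> \<omega>} | A t. 0 \<le> t \<and> A \<in> sets (F t)} \<subseteq> Pow (space M)"
  using sets.sets_into_space[of _ "F 0"] space_F[of 0] by auto

lemma space_strict_past: "space (strict_past (space M) F \<tau>) = space M"
  unfolding strict_past_def by (rule space_measure_of[OF strict_past_generator_Pow])

lemma strict_past_Int_less:
  assumes "0 \<le> t" "A \<in> sets (F t)"
  shows "A \<inter> {\<omega> \<in> space M. ennreal t < \<tau> \<omega>} \<in> sets (strict_past (space M) F \<tau>)"
  unfolding strict_past_def using assms
  by (subst sets_measure_of[OF strict_past_generator_Pow]) (rule sigma_sets.Basic, blast)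

text \<open>
  The convergence of the path to \<open>value_at Z \<tau>\<close> upgrades to convergence in mean by Scheffe's lemma,
  because the expectations agree.
\<close>

lemma integral_value_at:
  assumes Z0: "\<And>t \<omega>. 0 \<le> t \<Longrightarrow> \<omega> \<in> space M \<Longrightarrow> 0 \<le> Z t \<omega>"
    and cad: "cadlag_paths (space M) Z"
    and mart: "martingale M F (stopped Z \<tau>)"
    and int: "integrable M (value_at Z \<tau>)" "expectation (value_at Z \<tau>) = expectation (Z 0)"
    and t: "0 \<le> t" and A: "A \<in> sets (F t)"
  shows "(\<integral>\<omega>. value_at Z \<tau> \<omega> * indicator A \<omega> \<partial>M) = (\<integral>\<omega>. stopped Z \<tau> t \<omega> * indicator A \<omega> \<partial>M)"
proof -
  define X where "X = stopped Z \<tau>"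
  define V where "V = value_at Z \<tau>"
  interpret X: nonneg_martingale M F X
    by unfold_locales (use mart Z0 in \<open>auto simp: X_def stopped_def\<close>)
  have AM [measurable]: "A \<in> sets M" using sets_F_subset[OF t A] .
  have Xm [measurable]: "X (real n) \<in> borel_measurable M" for n by (rule X.X_measurable) simp
  have Vm [measurable]: "V \<in> borel_measurable M" and iV: "integrable M V" using int by (auto simp: V_def)
  have "AE \<omega> in M. \<exists>l. ((\<lambda>t. X t \<omega>) \<longlongrightarrow> l) at_top"
    using cad by (intro X.AE_convergent) (auto simp: X_def cadlag_paths_def intro!: stopped_right_continuous)
  then have lim: "AE \<omega> in M. ((\<lambda>t. X t \<omega>) \<longlongrightarrow> V \<omega>) at_top"
    by eventually_elim (simp add: X_def V_def stopped_tendsto_value_at)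
  have lim_n: "AE \<omega> in M. (\<lambda>n. X (real n) \<omega>) \<longlonglongrightarrow> V \<omega>"
    using lim by eventually_elim (rule filterlim_compose[OF _ filterlim_real_sequentially])
  have Vpos: "AE \<omega> in M. 0 \<le> V \<omega>"
    using lim_n AE_space by eventually_elim (rule LIMSEQ_le_const, auto intro!: X.nonneg)
  have X0: "X 0 = Z 0" by (simp add: fun_eq_iff X_def stopped_def min_absorb2)
  \<comment> \<open>For Scheffe's lemma the norms must agree in the limit. By nonnegativity they are
    means, constant in \<open>n\<close> and equal to that of the limit by hypothesis.\<close>
  have norm_X: "(\<integral>\<^sup>+\<omega>. norm (X (real n) \<omega>) \<partial>M) = ennreal (expectation (Z 0))" for n
  proof -
    have "(\<integral>\<^sup>+\<omega>. norm (X (real n) \<omega>) \<partial>M) = (\<integral>\<^sup>+\<omega>. ennreal (X (real n) \<omega>) \<partial>M)"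
      using X.nonneg by (intro nn_integral_cong) simp
    also have "\<dots> = ennreal (expectation (X (real n)))"
      using X.X_integrable X.nonneg by (intro nn_integral_eq_integral) auto
    finally show ?thesis using X.expectation_const[of "real n"] X0 by simp
  qed
  have norm_V: "(\<integral>\<^sup>+\<omega>. norm (V \<omega>) \<partial>M) = ennreal (expectation (Z 0))"
  proof -
    have "(\<integral>\<^sup>+\<omega>. norm (V \<omega>) \<partial>M) = (\<integral>\<^sup>+\<omega>. ennreal (V \<omega>) \<partial>M)"
      by (rule nn_integral_cong_AE) (use Vpos in eventually_elim, simp)
    also have "\<dots> = ennreal (expectation V)"
      using iV Vpos by (rule nn_integral_eq_integral)
    finally show ?thesis using int(2) by (simp add: V_def)
  qed
  have L1: "(\<lambda>n. \<integral>\<^sup>+\<omega>. norm (X (real n) \<omega> - V \<omega>) \<partial>M) \<longlonglongrightarrow> 0"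
    by (rule Scheffe_lemma2[OF Xm iV lim_n]) (simp only: norm_X norm_V order_refl)
  have iXA: "integrable M (\<lambda>\<omega>. X (real n) \<omega> * indicator A \<omega>)" for n
    by (intro integrable_real_mult_indicator X.X_integrable AM) simp
  have iVA: "integrable M (\<lambda>\<omega>. V \<omega> * indicator A \<omega>)"
    by (intro integrable_real_mult_indicator iV AM)
  have "(\<lambda>n. \<integral>\<^sup>+\<omega>. norm (X (real n) \<omega> * indicator A \<omega> - V \<omega> * indicator A \<omega>) \<partial>M) \<longlonglongrightarrow> 0"
  proof (rule tendsto_sandwich[OF _ _ tendsto_const L1])
    show "\<forall>\<^sub>F n in sequentially. (\<integral>\<^sup>+\<omega>. norm (X (real n) \<omega> * indicator A \<omega> - V \<omega> * indicator A \<omega>) \<partial>M)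
        \<le> (\<integral>\<^sup>+\<omega>. norm (X (real n) \<omega> - V \<omega>) \<partial>M)"
      by (intro always_eventually allI nn_integral_mono) (simp add: indicator_def)
  qed simp
  then have "(\<lambda>n. \<integral>\<omega>. X (real n) \<omega> * indicator A \<omega> \<partial>M) \<longlonglongrightarrow> (\<integral>\<omega>. V \<omega> * indicator A \<omega> \<partial>M)"
    using iXA iVA by (intro tendsto_L1_int) auto
  \<comment> \<open>As \<open>A\<close> belongs to \<open>F t\<close>, the martingale property makes
    the sequence constant once \<open>n\<close> has passed \<open>t\<close>.\<close>
  moreover have "\<forall>\<^sub>F n in sequentially.
      (\<integral>\<omega>. X (real n) \<omega> * indicator A \<omega> \<partial>M) = (\<integral>\<omega>. X t \<omega> * indicator A \<omega> \<partial>M)"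
    using eventually_ge_at_top[of "nat \<lceil>t\<rceil>"]
  proof eventually_elim
    case (elim n)
    then have "t \<le> real n" by linarith
    from martingale_integral_mult(2)[OF X.martingale t this, of "indicator A" 1] show ?case
      using A by (simp add: mult.commute)
  qed
  ultimately show ?thesis
    using LIMSEQ_unique[OF _ tendsto_eventually] unfolding X_def V_def by fast
qed

text \<open>Fatou's lemma along a localizing sequence. Extended nonnegative integrals avoid
  presupposing integrability of \<open>Z\<close>, which is itself derived from this
  inequality.\<close>

lemma nonneg_local_martingale_supermartingale:
  assumes Z0: "\<And>t \<omega>. 0 \<le> t \<Longrightarrow> \<omega> \<in> space M \<Longrightarrow> 0 \<le> Z t \<omega>"
    and loc: "local_martingale M F Z"
    and st: "0 \<le> s" "s \<le> t" and A: "A \<in> sets (F s)"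
  shows "(\<integral>\<^sup>+\<omega>. ennreal (Z t \<omega>) * indicator A \<omega> \<partial>M) \<le> (\<integral>\<^sup>+\<omega>. ennreal (Z s \<omega>) * indicator A \<omega> \<partial>M)"
proof -
  from loc obtain \<tau> :: "nat \<Rightarrow> 'a \<Rightarrow> ennreal" where \<tau>: "\<And>n. ext_stopping_time F (\<tau> n)"
      "AE \<omega> in M. (\<lambda>n. \<tau> n \<omega>) \<longlonglongrightarrow> \<infinity>" "\<And>n. martingale M F (stopped Z (\<tau> n))"
    unfolding local_martingale_def ui_martingale_def by auto
  \<comment> \<open>On \<open>A' n\<close>, an event of \<open>F s\<close>, stopping has not
    happened by time \<open>s\<close>, so the stopped process equals \<open>Z s\<close> there and
    the bound becomes independent of \<open>n\<close>. Almost every point of \<open>A\<close> lies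
    in \<open>A' n\<close> for all large \<open>n\<close>.\<close>
  define A' where "A' n = A \<inter> {\<omega> \<in> space M. ennreal s < \<tau> n \<omega>}" for n
  have t: "0 \<le> t" using st by simp
  have A'F: "A' n \<in> sets (F s)" for n
    unfolding A'_def using A ext_stopping_time_less[OF \<tau>(1) st(1)] by auto
  have [measurable]: "A' n \<in> sets M" for n using sets_F_subset[OF st(1) A'F] .
  have intX: "integrable M (stopped Z (\<tau> n) u)" if "0 \<le> u" for n u
    using \<tau>(3)[of n] that by (auto simp: martingale_def)
  have [measurable]: "stopped Z (\<tau> n) t \<in> borel_measurable M" for n using intX[OF t] by auto
  have pos: "0 \<le> stopped Z (\<tau> n) u \<omega>" if "\<omega> \<in> space M" for n u \<omega>
    using Z0[OF _ that] by (simp add: stopped_def)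
  have nn: "(\<integral>\<^sup>+\<omega>. ennreal (stopped Z (\<tau> n) u \<omega>) * indicator (A' n) \<omega> \<partial>M)
      = ennreal (\<integral>\<omega>. stopped Z (\<tau> n) u \<omega> * indicator (A' n) \<omega> \<partial>M)" if "0 \<le> u" for n u
  proof -
    have "(\<integral>\<^sup>+\<omega>. ennreal (stopped Z (\<tau> n) u \<omega>) * indicator (A' n) \<omega> \<partial>M)
        = (\<integral>\<^sup>+\<omega>. ennreal (stopped Z (\<tau> n) u \<omega> * indicator (A' n) \<omega>) \<partial>M)"
      by (intro nn_integral_cong) (simp add: indicator_def)
    also have "\<dots> = ennreal (\<integral>\<omega>. stopped Z (\<tau> n) u \<omega> * indicator (A' n) \<omega> \<partial>M)"
      by (intro nn_integral_eq_integral integrable_real_mult_indicator intX[OF that])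
        (use pos in \<open>auto intro!: AE_I2\<close>)
    finally show ?thesis .
  qed
  have bound: "(\<integral>\<^sup>+\<omega>. ennreal (stopped Z (\<tau> n) t \<omega>) * indicator (A' n) \<omega> \<partial>M)
      \<le> (\<integral>\<^sup>+\<omega>. ennreal (Z s \<omega>) * indicator A \<omega> \<partial>M)" for n
  proof -
    have "(\<integral>\<omega>. stopped Z (\<tau> n) t \<omega> * indicator (A' n) \<omega> \<partial>M) = (\<integral>\<omega>. stopped Z (\<tau> n) s \<omega> * indicator (A' n) \<omega> \<partial>M)"
      using martingale_integral_mult(2)[OF \<tau>(3) st, of "indicator (A' n)" 1 n] A'F
      by (simp add: mult.commute)
    then have "(\<integral>\<^sup>+\<omega>. ennreal (stopped Z (\<tau> n) t \<omega>) * indicator (A' n) \<omega> \<partial>M)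
        = (\<integral>\<^sup>+\<omega>. ennreal (stopped Z (\<tau> n) s \<omega>) * indicator (A' n) \<omega> \<partial>M)"
      using nn[OF t] nn[OF st(1)] by simp
    also have "\<dots> \<le> (\<integral>\<^sup>+\<omega>. ennreal (Z s \<omega>) * indicator A \<omega> \<partial>M)"
      by (intro nn_integral_mono)
        (auto simp: A'_def indicator_def stopped_def min_absorb2 less_imp_le st(1))
    finally show ?thesis .
  qed
  have "(\<integral>\<^sup>+\<omega>. ennreal (Z t \<omega>) * indicator A \<omega> \<partial>M)
      \<le> (\<integral>\<^sup>+\<omega>. liminf (\<lambda>n. ennreal (stopped Z (\<tau> n) t \<omega>) * indicator (A' n) \<omega>) \<partial>M)"
  proof (rule nn_integral_mono_AE)
    show "AE \<omega> in M. ennreal (Z t \<omega>) * indicator A \<omega>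
        \<le> liminf (\<lambda>n. ennreal (stopped Z (\<tau> n) t \<omega>) * indicator (A' n) \<omega>)"
      using \<tau>(2) AE_space
    proof eventually_elim
      case (elim \<omega>)
      have "\<forall>\<^sub>F n in sequentially. ennreal t < \<tau> n \<omega>"
        by (rule order_tendstoD(1)[OF elim(1)]) simp
      then have "\<forall>\<^sub>F n in sequentially. ennreal (Z t \<omega>) * indicator A \<omega>
          \<le> ennreal (stopped Z (\<tau> n) t \<omega>) * indicator (A' n) \<omega>"
      proof eventually_elim
        case (elim n)
        have "ennreal s < \<tau> n \<omega>" using ennreal_leI[OF st(2)] elim by (rule le_less_trans)
        then show ?case
          using elim \<open>\<omega> \<in> space M\<close> t by (simp add: A'_def indicator_def stopped_def min_absorb2 less_imp_le)
      qed
      then show ?case by (rule Liminf_bounded)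
    qed
  qed
  also have "\<dots> \<le> liminf (\<lambda>n. \<integral>\<^sup>+\<omega>. ennreal (stopped Z (\<tau> n) t \<omega>) * indicator (A' n) \<omega> \<partial>M)"
    by (rule nn_integral_liminf) measurable
  also have "\<dots> \<le> (\<integral>\<^sup>+\<omega>. ennreal (Z s \<omega>) * indicator A \<omega> \<partial>M)"
    using bound by (intro Liminf_le always_eventually allI) simp
  finally show ?thesis .
qed

lemma nonneg_local_martingale_integrable:
  assumes Z0: "\<And>t \<omega>. 0 \<le> t \<Longrightarrow> \<omega> \<in> space M \<Longrightarrow> 0 \<le> Z t \<omega>"
    and loc: "local_martingale M F Z" and int0: "integrable M (Z 0)" and t: "0 \<le> t"
  shows "integrable M (Z t)" and "expectation (Z t) \<le> expectation (Z 0)"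
proof -
  have Zm: "Z t \<in> borel_measurable M"
    using loc measurable_F_imp[OF t] t by (auto simp: local_martingale_def)
  have "space M \<in> sets (F 0)" using sets.top[of "F 0"] space_F[of 0] by simp
  then have "(\<integral>\<^sup>+\<omega>. ennreal (Z t \<omega>) * indicator (space M) \<omega> \<partial>M)
      \<le> (\<integral>\<^sup>+\<omega>. ennreal (Z 0 \<omega>) * indicator (space M) \<omega> \<partial>M)"
    using t by (intro nonneg_local_martingale_supermartingale[OF Z0 loc]) auto
  then have "(\<integral>\<^sup>+\<omega>. ennreal (Z t \<omega>) \<partial>M) \<le> (\<integral>\<^sup>+\<omega>. ennreal (Z 0 \<omega>) \<partial>M)"
    by (simp cong: nn_integral_cong)
  also have "\<dots> = ennreal (expectation (Z 0))"
    using Z0 int0 by (intro nn_integral_eq_integral) auto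
  finally have le: "(\<integral>\<^sup>+\<omega>. ennreal (Z t \<omega>) \<partial>M) \<le> ennreal (expectation (Z 0))" .
  show int: "integrable M (Z t)"
    using Zm Z0[OF t] le by (intro integrableI_nonneg) (auto intro: le_less_trans)
  have "(\<integral>\<^sup>+\<omega>. ennreal (Z t \<omega>) \<partial>M) = ennreal (expectation (Z t))"
    using Z0 t int by (intro nn_integral_eq_integral) auto
  then show "expectation (Z t) \<le> expectation (Z 0)"
    using le Z0 by (simp add: ennreal_le_iff Bochner_Integration.integral_nonneg)
qed

text \<open>The supermartingale inequalities over an event and over its complement add up to an
  equality of means, so neither can be strict. Only a lower bound on the mean is assumed, as the
  upper bound is automatic.\<close>

lemma nonneg_local_martingale_const_expectation:
  assumes Z0: "\<And>t \<omega>. 0 \<le> t \<Longrightarrow> \<omega> \<in> space M \<Longrightarrow> 0 \<le> Z t \<omega>"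
    and loc: "local_martingale M F Z" and int0: "integrable M (Z 0)"
    and const: "\<And>t. 0 \<le> t \<Longrightarrow> expectation (Z 0) \<le> expectation (Z t)"
  shows "martingale M F Z"
  unfolding martingale_def
proof (intro conjI allI impI)
  have E: "expectation (Z t) = expectation (Z 0)" if "0 \<le> t" for t
    using nonneg_local_martingale_integrable[OF Z0 loc int0 that] const[OF that] by simp
  show Zm: "Z t \<in> borel_measurable (F t)" if "0 \<le> t" for t
    using loc that by (simp add: local_martingale_def)
  show int: "integrable M (Z t)" if "0 \<le> t" for t
    by (rule nonneg_local_martingale_integrable[OF Z0 loc int0 that])
  fix s t :: real assume st: "0 \<le> s" "s \<le> t"
  then have t: "0 \<le> t" by simp
  interpret sub: finite_measure_subalgebra M "F s"
    by unfold_locales (rule subalgebra_F[OF st(1)])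
  have le: "(LINT \<omega>:A|M. Z t \<omega>) \<le> (LINT \<omega>:A|M. Z s \<omega>)" if A: "A \<in> sets (F s)" for A
  proof -
    have AM: "A \<in> sets M" using sets_F_subset[OF st(1) A] .
    have nn: "(\<integral>\<^sup>+\<omega>. ennreal (Z u \<omega>) * indicator A \<omega> \<partial>M) = ennreal (LINT \<omega>:A|M. Z u \<omega>)" if "0 \<le> u" for u
    proof -
      have "(\<integral>\<^sup>+\<omega>. ennreal (Z u \<omega>) * indicator A \<omega> \<partial>M) = (\<integral>\<^sup>+\<omega>. ennreal (indicator A \<omega> *\<^sub>R Z u \<omega>) \<partial>M)"
        by (intro nn_integral_cong) (simp add: indicator_def)
      also have "\<dots> = ennreal (LINT \<omega>:A|M. Z u \<omega>)"
        unfolding set_lebesgue_integral_def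
        by (intro nn_integral_eq_integral integrable_mult_indicator AM int[OF that])
          (use Z0[OF that] in \<open>auto intro!: AE_I2\<close>)
      finally show ?thesis .
    qed
    have "0 \<le> (LINT \<omega>:A|M. Z s \<omega>)"
      unfolding set_lebesgue_integral_def using Z0[OF st(1)] by (intro Bochner_Integration.integral_nonneg) auto
    then show ?thesis
      using nonneg_local_martingale_supermartingale[OF Z0 loc st A] nn[OF t] nn[OF st(1)]
      by (simp add: ennreal_le_iff)
  qed
  show "AE \<omega> in M. real_cond_exp M (F s) (Z t) \<omega> = Z s \<omega>"
  proof (rule sub.real_cond_exp_charact)
    fix A assume A: "A \<in> sets (F s)"
    define C where "C = space M - A"
    have C: "C \<in> sets (F s)" unfolding C_def using A space_F[OF st(1)] by (metis sets.compl_sets)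
    have AM: "A \<in> sets M" "C \<in> sets M" using sets_F_subset[OF st(1)] A C by auto
    have split: "expectation (Z u) = (LINT \<omega>:A|M. Z u \<omega>) + (LINT \<omega>:C|M. Z u \<omega>)" if "0 \<le> u" for u
    proof -
      have "(LINT \<omega>:A \<union> C|M. Z u \<omega>) = (LINT \<omega>:A|M. Z u \<omega>) + (LINT \<omega>:C|M. Z u \<omega>)"
        by (intro set_integral_Un[unfolded set_integrable_def] integrable_mult_indicator AM int that)
          (auto simp: C_def)
      moreover have "A \<union> C = space M" unfolding C_def using sets.sets_into_space[OF AM(1)] by auto
      ultimately show ?thesis using int[OF that] by (simp add: set_integral_space)
    qed
    show "(LINT \<omega>:A|M. Z t \<omega>) = (LINT \<omega>:A|M. Z s \<omega>)"
      using split[OF t] split[OF st(1)] E[OF t] E[OF st(1)] le[OF A] le[OF C] by linarith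
  qed (use int t st Zm in auto)
qed

end

section \<open>The martingale property of the density process\<close>

theorem proposition3p22:
  fixes M Q :: "'a measure"
    and F :: "real \<Rightarrow> 'a measure"
    and Z :: "real \<Rightarrow> 'a \<Rightarrow> real"
    and \<rho> :: "nat \<Rightarrow> 'a \<Rightarrow> ennreal"
    and \<rho>_lim :: "'a \<Rightarrow> ennreal"
  assumes "filtered_prob_space M F"
    and "right_continuous_filtration F"
    and "\<And>t \<omega>. 0 \<le> t \<Longrightarrow> \<omega> \<in> space M \<Longrightarrow> 0 \<le> Z t \<omega>"
    and "local_martingale M F Z"
    and "AE \<omega> in M. Z 0 \<omega> = 1"
    and "\<And>n. ext_stopping_time F (\<rho> n)"
    and "\<And>\<omega>. \<omega> \<in> space M \<Longrightarrow> incseq (\<lambda>n. \<rho> n \<omega>)"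
    and "\<And>n. ui_martingale M F (stopped Z (\<rho> n))"
    and "\<And>\<omega>. \<omega> \<in> space M \<Longrightarrow> (\<lambda>n. \<rho> n \<omega>) \<longlonglongrightarrow> \<rho>_lim \<omega>"
    and "standard_system (UNIV :: nat set) (space M) (\<lambda>n. strict_past (space M) F (\<rho> n))"
    and "prob_space Q"
    and "sets Q = sets (strict_past (space M) F \<rho>_lim)"
    and "\<And>n A. A \<in> sets (strict_past (space M) F (\<rho> n)) \<Longrightarrow>
           measure Q A = (LINT \<omega>|M. value_at Z (\<rho> n) \<omega> * indicator A \<omega>)"
  shows "((\<forall>t\<ge>0. (\<lambda>n. measure Q {\<omega> \<in> space Q. \<rho> n \<omega> > ennreal t}) \<longlonglongrightarrow> 1)
            \<longrightarrow> martingale M F Z) \<and>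
         ((AE \<omega> in M. (\<lambda>n. \<rho> n \<omega>) \<longlonglongrightarrow> \<infinity>) \<and> martingale M F Z
            \<longrightarrow> (\<forall>t\<ge>0. (\<lambda>n. measure Q {\<omega> \<in> space Q. \<rho> n \<omega> > ennreal t}) \<longlonglongrightarrow> 1)) \<and>
         ((\<lambda>n. measure Q {\<omega> \<in> space Q. \<rho> n \<omega> = \<infinity>}) \<longlonglongrightarrow> 1
            \<longrightarrow> ui_martingale M F Z)"
proof -
  interpret filtered_prob_space M F by fact
  interpret Q: prob_space Q by fact
  note Z0 = assms(3) and loc = assms(4) and \<rho> = assms(6) and Q_eq = assms(13)
  have cad: "cadlag_paths (space M) Z" using loc by (simp add: local_martingale_def)
  have mart: "martingale M F (stopped Z (\<rho> n))" for n using assms(8) by (simp add: ui_martingale_def)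
  have spQ: "space Q = space M" using sets_eq_imp_space_eq[OF assms(12)] by (simp add: space_strict_past)
  define G where "G n t = {\<omega> \<in> space M. ennreal t < \<rho> n \<omega>}" for n t
  have G_F: "G n t \<in> sets (F t)" if "0 \<le> t" for n t
    unfolding G_def using ext_stopping_time_less[OF \<rho> that] .
  have G_M: "G n t \<in> sets M" if "0 \<le> t" for n t using sets_F_subset[OF that G_F[OF that]] .
  have Zm: "Z t \<in> borel_measurable M" if "0 \<le> t" for t
    using loc measurable_F_imp[OF that] that by (auto simp: local_martingale_def)
  have int0: "integrable M (Z 0)" and E0: "expectation (Z 0) = 1"
  proof -
    show "integrable M (Z 0)"
      using Zm[of 0] assms(5) by (subst integrable_cong_AE[where g = "\<lambda>_. 1"]) auto
    have "expectation (Z 0) = (\<integral>\<omega>. 1 \<partial>M)" using Zm[of 0] assms(5) by (intro integral_cong_AE) auto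
    then show "expectation (Z 0) = 1" by (simp add: prob_space)
  qed
  have int: "integrable M (Z t)" and E_le: "expectation (Z t) \<le> 1" if "0 \<le> t" for t
    using nonneg_local_martingale_integrable[OF Z0 loc int0 that] E0 by auto
  have intG: "integrable M (\<lambda>\<omega>. Z t \<omega> * indicator (G n t) \<omega>)" if "0 \<le> t" for n t
    using integrable_real_mult_indicator[OF G_M[OF that] int[OF that]] .

  \<comment> \<open>The measure \<open>Q\<close> expressed through \<open>Z\<close> and
    \<open>M\<close>\<close>
  have EV: "expectation (value_at Z (\<rho> n)) = 1" for n
  proof -
    have "space M \<in> sets (strict_past (space M) F (\<rho> n))" by (metis sets.top space_strict_past)
    from Q_eq[OF this] have "measure Q (space M) = (\<integral>\<omega>. value_at Z (\<rho> n) \<omega> * indicator (space M) \<omega> \<partial>M)" .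
    also have "\<dots> = expectation (value_at Z (\<rho> n))" by (intro Bochner_Integration.integral_cong) auto
    finally show ?thesis using Q.prob_space spQ by simp
  qed
  \<comment> \<open>The integral of a non-integrable function is 0 by convention, so mean 1 forces
    integrability.\<close>
  then have intV: "integrable M (value_at Z (\<rho> n))" for n by (metis not_integrable_integral_eq zero_neq_one)

  \<comment> \<open>The event lies in the strict past of \<open>\<rho> n\<close>, where
    \<open>value_at Z (\<rho> n)\<close> is the density of \<open>Q\<close>, and also in
    \<open>F t\<close>, where the closed martingale can be evaluated at \<open>t\<close>. On it,
    stopping has not yet happened.\<close>
  have Q_gt: "measure Q {\<omega> \<in> space Q. \<rho> n \<omega> > ennreal t} = (\<integral>\<omega>. Z t \<omega> * indicator (G n t) \<omega> \<partial>M)"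
    if t: "0 \<le> t" for n t
  proof -
    have "space M \<in> sets (F t)" using sets.top[of "F t"] space_F[OF t] by simp
    from strict_past_Int_less[OF t this, of "\<rho> n"]
    have "G n t \<in> sets (strict_past (space M) F (\<rho> n))" by (simp add: G_def Int_def)
    from Q_eq[OF this] have "measure Q (G n t) = (\<integral>\<omega>. value_at Z (\<rho> n) \<omega> * indicator (G n t) \<omega> \<partial>M)" .
    also have "\<dots> = (\<integral>\<omega>. stopped Z (\<rho> n) t \<omega> * indicator (G n t) \<omega> \<partial>M)"
      using EV E0 by (intro integral_value_at Z0 cad mart intV t G_F) auto
    also have "\<dots> = (\<integral>\<omega>. Z t \<omega> * indicator (G n t) \<omega> \<partial>M)"
      by (intro Bochner_Integration.integral_cong)
        (auto simp: G_def indicator_def stopped_def min_absorb2 less_imp_le t)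
    finally show ?thesis by (simp add: G_def spQ)
  qed

  \<comment> \<open>Martingale property from the behaviour of \<open>Q\<close>\<close>
  have part1: "martingale M F Z"
    if Q_lim: "\<forall>t\<ge>0. (\<lambda>n. measure Q {\<omega> \<in> space Q. \<rho> n \<omega> > ennreal t}) \<longlonglongrightarrow> 1"
  proof (rule nonneg_local_martingale_const_expectation[OF Z0 loc int0])
    fix t :: real assume t: "0 \<le> t"
    \<comment> \<open>By nonnegativity, dropping the indicator only increases the integral; the
      limit then bounds the mean of \<open>Z t\<close> below by 1.\<close>
    have "measure Q {\<omega> \<in> space Q. \<rho> n \<omega> > ennreal t} \<le> expectation (Z t)" for n
      unfolding Q_gt[OF t]
      by (intro integral_mono intG int t) (auto simp: indicator_def Z0[OF t])
    then show "expectation (Z 0) \<le> expectation (Z t)"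
      unfolding E0 using LIMSEQ_le_const2[OF Q_lim[rule_format, OF t]] by blast
  qed

  \<comment> \<open>The converse under almost sure divergence of the stopping times\<close>
  have part2: "(\<lambda>n. measure Q {\<omega> \<in> space Q. \<rho> n \<omega> > ennreal t}) \<longlonglongrightarrow> 1"
    if \<rho>_lim: "AE \<omega> in M. (\<lambda>n. \<rho> n \<omega>) \<longlonglongrightarrow> \<infinity>" and Z: "martingale M F Z" and t: "0 \<le> t" for t
  proof -
    \<comment> \<open>The indicators are eventually 1 almost surely, and the integrable
      \<open>Z t\<close> dominates.\<close>
    have "(\<lambda>n. \<integral>\<omega>. Z t \<omega> * indicator (G n t) \<omega> \<partial>M) \<longlonglongrightarrow> expectation (Z t)"
    proof (rule integral_dominated_convergence[where w = "Z t"])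
      show "AE \<omega> in M. (\<lambda>n. Z t \<omega> * indicator (G n t) \<omega>) \<longlonglongrightarrow> Z t \<omega>"
        using \<rho>_lim AE_space
      proof eventually_elim
        case (elim \<omega>)
        have "\<forall>\<^sub>F n in sequentially. ennreal t < \<rho> n \<omega>"
          by (rule order_tendstoD(1)[OF elim(1)]) simp
        then have "\<forall>\<^sub>F n in sequentially. Z t \<omega> * indicator (G n t) \<omega> = Z t \<omega>"
          by eventually_elim (use elim(2) in \<open>simp add: G_def\<close>)
        then show ?case by (rule tendsto_eventually)
      qed
    qed (use intG[OF t] int[OF t] Z0[OF t] Zm[OF t] in \<open>auto simp: indicator_def\<close>)
    moreover have "expectation (Z t) = 1"
      using martingale_integral_mult(2)[OF Z order_refl t, of "\<lambda>_. 1" 1] E0 by simp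
    ultimately show ?thesis by (simp add: Q_gt[OF t])
  qed

  \<comment> \<open>Uniform integrability\<close>
  have part3: "ui_martingale M F Z"
    if inf: "(\<lambda>n. measure Q {\<omega> \<in> space Q. \<rho> n \<omega> = \<infinity>}) \<longlonglongrightarrow> 1"
  proof -
    have Q_mono: "measure Q {\<omega> \<in> space Q. \<rho> n \<omega> = \<infinity>} \<le> measure Q {\<omega> \<in> space Q. \<rho> n \<omega> > ennreal t}"
      if t: "0 \<le> t" for n t
    proof (rule Q.finite_measure_mono)
      \<comment> \<open>Monotonicity of \<open>Q\<close> requires the larger event to lie in the
        strict past of \<open>\<rho>_lim\<close>. Intersecting with \<open>t < \<rho>_lim\<close>
        puts it in generator form and changes nothing, since
        \<open>\<rho> n \<le> \<rho>_lim\<close>.\<close>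
      have "G n t \<inter> {\<omega> \<in> space M. ennreal t < \<rho>_lim \<omega>} \<in> sets Q"
        unfolding assms(12) by (rule strict_past_Int_less[OF t G_F[OF t]])
      moreover have "\<rho> n \<omega> \<le> \<rho>_lim \<omega>" if "\<omega> \<in> space M" for \<omega>
        by (rule incseq_le[OF assms(7)[OF that] assms(9)[OF that]])
      then have "G n t \<inter> {\<omega> \<in> space M. ennreal t < \<rho>_lim \<omega>} = {\<omega> \<in> space Q. \<rho> n \<omega> > ennreal t}"
        unfolding G_def spQ by (auto intro: less_le_trans)
      ultimately show "{\<omega> \<in> space Q. \<rho> n \<omega> > ennreal t} \<in> sets Q" by simp
    qed auto
    have Z: "martingale M F Z"
    proof (rule part1, intro allI impI)
      fix t :: real assume t: "0 \<le> t"
      show "(\<lambda>n. measure Q {\<omega> \<in> space Q. \<rho> n \<omega> > ennreal t}) \<longlonglongrightarrow> 1"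
        by (rule tendsto_sandwich[OF _ _ inf tendsto_const])
          (auto intro!: always_eventually Q_mono[OF t, unfolded infinity_ennreal_def])
    qed
    moreover have "uniformly_integrable M {0..} Z"
      unfolding uniformly_integrable_def
    proof (intro conjI ballI allI impI)
      fix t :: real assume "t \<in> {0..}"
      then show "integrable M (Z t)" by (simp add: int)
    next
      fix \<epsilon> :: real assume "0 < \<epsilon>"
      have "\<forall>\<^sub>F n in sequentially. 1 - \<epsilon>/2 < measure Q {\<omega> \<in> space Q. \<rho> n \<omega> = \<infinity>}"
        by (rule order_tendstoD(1)[OF inf]) (use \<open>0 < \<epsilon>\<close> in simp)
      \<comment> \<open>This \<open>n\<close> serves all \<open>t\<close> at once, because by
        \<open>Q_mono\<close> the bound passes to the event \<open>\<rho> n > t\<close> for every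
        \<open>t\<close>.\<close>
      then obtain n where n: "1 - \<epsilon>/2 < measure Q {\<omega> \<in> space Q. \<rho> n \<omega> = \<infinity>}"
        by (auto simp: eventually_sequentially)
      define S where "S = stopped Z (\<rho> n)"
      have S: "uniformly_integrable M {0..} S" using assms(8)[of n] by (simp add: ui_martingale_def S_def)
      obtain K where K: "\<And>t. 0 \<le> t \<Longrightarrow> (LINT \<omega>:{\<omega> \<in> space M. K < \<bar>S t \<omega>\<bar>}|M. \<bar>S t \<omega>\<bar>) \<le> \<epsilon>/2"
        using S \<open>0 < \<epsilon>\<close> unfolding uniformly_integrable_def by (metis atLeast_iff half_gt_zero)
      show "\<exists>K. \<forall>t\<in>{0..}. (LINT \<omega>:{\<omega> \<in> space M. K < \<bar>Z t \<omega>\<bar>}|M. \<bar>Z t \<omega>\<bar>) \<le> \<epsilon>"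
      proof (intro exI[of _ K] ballI)
        fix t :: real assume "t \<in> {0..}"
        then have t: "0 \<le> t" by simp
        have iS: "integrable M (S t)" using S t by (simp add: uniformly_integrable_def)
        note [measurable] = Zm[OF t] borel_measurable_integrable[OF iS]
        have iS': "integrable M (\<lambda>\<omega>. indicator {\<omega> \<in> space M. K < \<bar>S t \<omega>\<bar>} \<omega> *\<^sub>R \<bar>S t \<omega>\<bar>)"
          using iS by (intro integrable_mult_indicator) auto
        \<comment> \<open>On \<open>G n t\<close> the processes \<open>Z\<close> and
          \<open>S\<close> agree at \<open>t\<close>, so the tail of \<open>S\<close> suffices; off
          \<open>G n t\<close> the first summand is all of \<open>Z t\<close>.\<close>
        have "(LINT \<omega>:{\<omega> \<in> space M. K < \<bar>Z t \<omega>\<bar>}|M. \<bar>Z t \<omega>\<bar>)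
            \<le> (\<integral>\<omega>. (Z t \<omega> - Z t \<omega> * indicator (G n t) \<omega>)
                 + indicator {\<omega> \<in> space M. K < \<bar>S t \<omega>\<bar>} \<omega> *\<^sub>R \<bar>S t \<omega>\<bar> \<partial>M)"
          unfolding set_lebesgue_integral_def
        proof (rule integral_mono)
          show "integrable M (\<lambda>\<omega>. indicator {\<omega> \<in> space M. K < \<bar>Z t \<omega>\<bar>} \<omega> *\<^sub>R \<bar>Z t \<omega>\<bar>)"
            using int[OF t] by (intro integrable_mult_indicator) auto
          show "integrable M (\<lambda>\<omega>. (Z t \<omega> - Z t \<omega> * indicator (G n t) \<omega>)
                 + indicator {\<omega> \<in> space M. K < \<bar>S t \<omega>\<bar>} \<omega> *\<^sub>R \<bar>S t \<omega>\<bar>)"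
            by (intro Bochner_Integration.integrable_add Bochner_Integration.integrable_diff int intG t iS')
          fix \<omega> assume \<omega>: "\<omega> \<in> space M"
          have "S t \<omega> = Z t \<omega>" if "\<omega> \<in> G n t"
            using that t by (simp add: S_def G_def stopped_def min_absorb2 less_imp_le)
          then show "indicator {\<omega> \<in> space M. K < \<bar>Z t \<omega>\<bar>} \<omega> *\<^sub>R \<bar>Z t \<omega>\<bar>
              \<le> (Z t \<omega> - Z t \<omega> * indicator (G n t) \<omega>)
                + indicator {\<omega> \<in> space M. K < \<bar>S t \<omega>\<bar>} \<omega> *\<^sub>R \<bar>S t \<omega>\<bar>"
            using Z0[OF t \<omega>] by (cases "\<omega> \<in> G n t") (auto simp: indicator_def)
        qed
        also have "\<dots> = (expectation (Z t) - (\<integral>\<omega>. Z t \<omega> * indicator (G n t) \<omega> \<partial>M))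
            + (LINT \<omega>:{\<omega> \<in> space M. K < \<bar>S t \<omega>\<bar>}|M. \<bar>S t \<omega>\<bar>)"
          unfolding set_lebesgue_integral_def using int[OF t] intG[OF t] iS' by simp
        \<comment> \<open>The first bracket is at most \<open>1 - Q (\<rho> n > t)\<close> by
          \<open>E_le\<close> and \<open>Q_gt\<close>, hence below \<open>\<epsilon>/2\<close> by
          the choice of \<open>n\<close>.\<close>
        also have "\<dots> \<le> \<epsilon>/2 + \<epsilon>/2"
          using E_le[OF t] Q_gt[OF t, of n] Q_mono[OF t, of n] n K[OF t] by (intro add_mono) linarith+
        finally show "(LINT \<omega>:{\<omega> \<in> space M. K < \<bar>Z t \<omega>\<bar>}|M. \<bar>Z t \<omega>\<bar>) \<le> \<epsilon>" by simp
      qed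
    qed
    ultimately show ?thesis by (simp add: ui_martingale_def)
  qed

  show ?thesis using part1 part2 part3 by blast
qed

end
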